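(* \[\sum_{k=0}^{\infty}\left(\frac{1}{64}\right)^k\frac{(\frac{1}{2})_k^3}{(1)_k^3}\left\{(42k+5)\Big[17H_{2k}^{(3)}-2H_{k}^{(3)}\Big]-\frac{27}{(2k+1)^2}\right\}=\frac{240\,\zeta(3)}{\pi}-128\,G,\] where $G=\sum_{k=1}^{\infty}\frac{(-1)^{k-1}}{(2k-1)^2}$ is the Catalan constant.
   Context: For a number $x$ and a nonnegative integer $m$, the shifted factorial is $(x)_0=1$ and $(x)_m=x(x+1)\cdots(x+m-1)$ for $m\ge 1$; $(x)_k^3$ means $((x)_k)^3$. For $\ell\in\mathbb{Z}^{+}$ and an integer $n\ge 0$, the harmonic number of order $\ell$ is $H_n^{(\ell)}=\sum_{k=1}^n \frac{1}{k^{\ell}}$ (so $H_0^{(\ell)}=0$). $\zeta(s)=\sum_{k=1}^\infty k^{-s}$ is the Riemann zeta function for $\Re(s)>1$. *)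

theory Defs
  imports "HOL-Analysis.Analysis"
begin

definition gen_harm :: "nat \<Rightarrow> nat \<Rightarrow> real" where
  "gen_harm l n = (\<Sum>k=1..n. 1 / real k ^ l)"

text \<open>The series over \<open>k \<ge> 1\<close> below are indexed from 0, with \<open>Suc k\<close> in place of \<open>k\<close>.\<close>

text \<open>The type may be \<^typ>\<open>complex\<close> or \<^typ>\<open>real\<close>; the value is meaningful only for real part
  greater than 1, where the series converges (there is no analytic continuation).\<close>

definition zeta :: "'a \<Rightarrow> 'a :: {real_normed_field, ln}" where
  "zeta s = (\<Sum>k. of_nat (Suc k) powr (- s))"

definition catalan_const :: real where
  "catalan_const = (\<Sum>k. (-1) ^ k / (2 * real (Suc k) - 1)\<^sup>2)"

end

theory Submission
  imports Defs
begin

text \<open>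
  The series is the derivative at \<open>y = 0\<close> of a one-parameter deformation of Ramanujan's series
  \<open>\<Sum> (1/2)_n^3 / (64^n n!^3) (42 n + 5) = 16 / pi\<close>. Its coefficients are
  \<open>((1/2)_n^3)^2 / (2 n)!^3\<close>. Replacing every factor \<open>(i + 1/2)^3\<close> of the numerator by
  \<open>(i + 1/2)^3 + y\<close> and every factor \<open>i^3\<close> of the denominator by \<open>i^3 - y\<close> produces, by logarithmic differentiation, the weight
  \<open>2 (8 H_2n - H_n) + H_2n = 17 H_2n - 2 H_n\<close> with harmonic numbers of order 3. The deformed
  term \<open>fast_term y n\<close> carries in addition a rational factor that contributes \<open>- 27 / (2 n + 1)^2\<close>.

  For \<open>y = w^3\<close> with a small negative \<open>w\<close>, both cubics split off a real linear factor, and the deformed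
  series is the boundary sum of a Wilf--Zeilberger pair whose other boundary is \<open>- w\<close> times a
  \<open>3F2\<close> series at argument 1 (\<open>fast_sums_damped\<close>). This pair comes from the
  fact that the well-poised sum \<open>\<Sum> (-1)^k (a + 2 k) (b)_k (c)_k (d)_k / ((1+a-b)_k (1+a-c)_k (1+a-d)_k)\<close>
  equals an explicit term plus an explicit multiple of the sum with parameters \<open>(a + 1; b, c, d + 1)\<close>,
  and likewise with the roles of \<open>b\<close>, \<open>c\<close> and \<open>d\<close> permuted. Here
  \<open>a = 1/2\<close> and \<open>b, c, d = 1/2 + \<omega>^j w\<close> with \<open>\<omega>\<close> a primitive cube root of unity. Iterating one
  shift leads to the \<open>3F2\<close> series, iterating the composition of the three shifts to the fast series.

  The \<open>3F2\<close> series diverges at \<open>w = 0\<close>, so its expansion needs care. Its terms are those of a Gauss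
  series times a decreasing damping product close to 1. Abel summation and Gauss's theorem give
  (\<open>fast_sums_corrected\<close>)

  \<open>\<Sum> fast_term (w^3) n = 16 (A / pi - w^3 \<Sum> corr_term w k)\<close>, where
  \<open>A = \<Prod> (1 - w^3 / i^3)^(-1) = 1 + zeta 3 w^3 + o(w^3)\<close>.

  As \<open>w\<close> tends to 0 from the left, the correction sum tends to \<open>\<Sum> (c_0^2 + ... + c_m^2) / (m + 1)^2\<close>
  with the Wallis ratios \<open>c_k = (1/2)_k / k!\<close>. A second application of Gauss's theorem turns
  this sum into \<open>(1/pi) \<Sum> 1 / (n^3 c_n^2)\<close>. The arcsine series shows that
  \<open>\<Sum> 1 / (n^3 c_n^2)\<close> is four times the integral of \<open>x^2 / sin x\<close> over \<open>[0, pi/2]\<close>, and the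
  sine expansion of \<open>1 / sin x\<close> evaluates it as \<open>8 pi G - 14 zeta 3\<close>. Hence the derivative at
  \<open>y = 0\<close> is \<open>16 (zeta 3 / pi - 8 G + 14 zeta 3 / pi) = 240 zeta 3 / pi - 128 G\<close>.
\<close>

section \<open>Gauss's summation theorem\<close>

lemma pos_notin_nonpos_Ints: "x > 0 \<Longrightarrow> x \<notin> \<int>\<^sub>\<le>\<^sub>0" for x :: real
  by (auto simp: nonpos_Ints_def)

text \<open>Both Pochhammer symbols are compared with Euler's product for the Gamma function.\<close>

lemma pochhammer_ratio_asymptotics:
  fixes a b :: real
  assumes "a > 0" "b > 0"
  shows "(\<lambda>n. pochhammer a n / pochhammer b n * real n powr (b - a)) \<longlonglongrightarrow> Gamma b / Gamma a"
proof -
  have "(\<lambda>n. Gamma_series' b n / Gamma_series' a n) \<longlonglongrightarrow> Gamma b / Gamma a"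
    using assms by (intro tendsto_divide Gamma_series'_LIMSEQ) (auto simp: Gamma_eq_zero_iff nonpos_Ints_def)
  moreover have "\<forall>\<^sub>F n in sequentially. Gamma_series' b n / Gamma_series' a n
                   = pochhammer a n / pochhammer b n * real n powr (b - a)"
    using eventually_gt_at_top[of 0]
  proof eventually_elim
    case (elim n)
    have "pochhammer a n > 0" "pochhammer b n > 0" using assms by (auto intro!: pochhammer_pos)
    then show ?case using elim
      by (simp add: Gamma_series'_def powr_def left_diff_distrib exp_diff field_simps)
  qed
  ultimately show ?thesis by (rule Lim_transform_eventually)
qed

definition gauss_term :: "real \<Rightarrow> real \<Rightarrow> real \<Rightarrow> nat \<Rightarrow> real" where
  "gauss_term a b c k = pochhammer a k * pochhammer b k / (pochhammer c k * fact k)"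

lemma gauss_term_0 [simp]: "gauss_term a b c 0 = 1"
  by (simp add: gauss_term_def)

lemma gauss_term_Suc:
  "gauss_term a b c (Suc k) = gauss_term a b c k * ((a + real k) * (b + real k) / ((c + real k) * (real k + 1)))"
  by (simp add: gauss_term_def pochhammer_Suc mult_ac add_ac)

lemma gauss_term_pos: "a > 0 \<Longrightarrow> b > 0 \<Longrightarrow> c > 0 \<Longrightarrow> gauss_term a b c k > 0"
  by (simp add: gauss_term_def pochhammer_pos)

lemma gauss_term_asymptotics:
  assumes "a > 0" "b > 0" "c > 0"
  shows "(\<lambda>k. gauss_term a b c k * real k powr (c + 1 - a - b)) \<longlonglongrightarrow> Gamma c / (Gamma a * Gamma b)"
proof -
  have "(\<lambda>k. (pochhammer a k / pochhammer c k * real k powr (c - a)) *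
             (pochhammer b k / pochhammer 1 k * real k powr (1 - b)))
        \<longlonglongrightarrow> Gamma c / Gamma a * (Gamma 1 / Gamma b)"
    using assms by (intro tendsto_mult pochhammer_ratio_asymptotics) auto
  moreover have "(pochhammer a k / pochhammer c k * real k powr (c - a)) *
             (pochhammer b k / pochhammer 1 k * real k powr (1 - b))
             = gauss_term a b c k * real k powr (c + 1 - a - b)" for k
    by (simp add: gauss_term_def pochhammer_fact powr_diff powr_add mult_ac)
  ultimately show ?thesis by simp
qed

lemma gauss_term_tendsto_0:
  assumes "a > 0" "b > 0" "c > a + b"
  shows "(\<lambda>k. real k * gauss_term a b c k) \<longlonglongrightarrow> 0"
proof -
  have "(\<lambda>k. gauss_term a b c k * real k powr (c + 1 - a - b) * real k powr (a + b - c))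
         \<longlonglongrightarrow> Gamma c / (Gamma a * Gamma b) * 0"
    using assms by (intro tendsto_mult gauss_term_asymptotics tendsto_neg_powr filterlim_real_sequentially) auto
  moreover have "gauss_term a b c k * real k powr (c + 1 - a - b) * real k powr (a + b - c)
                 = real k * gauss_term a b c k" for k
  proof -
    have "real k powr (c + 1 - a - b) * real k powr (a + b - c) = real k powr 1"
      by (subst powr_add [symmetric]) simp
    then show ?thesis by (simp add: mult.assoc)
  qed
  ultimately show ?thesis by simp
qed

lemma summable_gauss_term:
  assumes "a > 0" "b > 0" "c > a + b"
  shows "summable (gauss_term a b c)"
proof -
  have "Bseq (\<lambda>k. gauss_term a b c k * real k powr (c + 1 - a - b))"
    using gauss_term_asymptotics[of a b c] assms
    by (intro convergent_imp_Bseq convergentI[of _ "Gamma c / (Gamma a * Gamma b)"]) auto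
  then obtain K where K: "\<And>k. norm (gauss_term a b c k * real k powr (c + 1 - a - b)) \<le> K"
    by (auto simp: Bseq_def)
  show ?thesis
  proof (rule summable_comparison_test')
    show "summable (\<lambda>k. K * real k powr (a + b - c - 1))"
      using assms by (intro summable_mult) (auto simp: summable_real_powr_iff)
    show "norm (gauss_term a b c k) \<le> K * real k powr (a + b - c - 1)" if "k \<ge> 1" for k
    proof -
      have "real k powr (c + 1 - a - b) * real k powr (a + b - c - 1) = 1"
        using that by (subst powr_add [symmetric]) simp
      then have "norm (gauss_term a b c k)
          = norm (gauss_term a b c k * real k powr (c + 1 - a - b)) * real k powr (a + b - c - 1)"
        by (simp add: abs_mult mult.assoc)
      also have "\<dots> \<le> K * real k powr (a + b - c - 1)"
        by (intro mult_right_mono K) auto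
      finally show ?thesis .
    qed
  qed
qed

text \<open>The two series differ term by term by the forward difference of \<open>c k\<close> times the
  \<open>k\<close>-th term, which vanishes at both ends when \<open>c > a + b\<close>.\<close>

lemma gauss_contiguity:
  assumes "a > 0" "b > 0" "c > a + b"
  shows "c * (c - a - b) * (\<Sum>k. gauss_term a b c k) = (c - a) * (c - b) * (\<Sum>k. gauss_term a b (c + 1) k)"
proof -
  have shift: "gauss_term a b (c + 1) k = gauss_term a b c k * (c / (c + k))" for k
  proof -
    have "pochhammer c (Suc k) = c * pochhammer (c + 1) k" "pochhammer c (Suc k) = pochhammer c k * (c + k)"
      by (rule pochhammer_rec, rule pochhammer_Suc)
    moreover have "pochhammer c k > 0" "pochhammer (c + 1) k > 0"
      using assms by (auto intro!: pochhammer_pos)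
    ultimately show ?thesis using assms by (simp add: gauss_term_def field_simps)
  qed
  let ?G = "\<lambda>k. c * (real k * gauss_term a b c k)"
  have cert: "?G (Suc k) - ?G k
     = (c - a) * (c - b) * gauss_term a b (c + 1) k - c * (c - a - b) * gauss_term a b c k" for k
  proof -
    have "c + k > 0" "real k + 1 > 0" using assms by auto
    then show ?thesis unfolding shift gauss_term_Suc of_nat_Suc
      by (simp add: divide_simps) (simp add: algebra_simps)
  qed
  have "(\<lambda>k. ?G (Suc k) - ?G k) sums (c * 0 - ?G 0)"
    by (rule telescope_sums) (intro tendsto_intros gauss_term_tendsto_0 assms)
  then have "(\<lambda>k. (c - a) * (c - b) * gauss_term a b (c + 1) k - c * (c - a - b) * gauss_term a b c k) sums 0"
    unfolding cert by simp
  moreover have "(\<lambda>k. (c - a) * (c - b) * gauss_term a b (c + 1) k - c * (c - a - b) * gauss_term a b c k) sums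
      ((c - a) * (c - b) * (\<Sum>k. gauss_term a b (c + 1) k) - c * (c - a - b) * (\<Sum>k. gauss_term a b c k))"
    using assms by (intro sums_diff sums_mult summable_sums summable_gauss_term) auto
  ultimately show ?thesis using sums_unique2 by fastforce
qed

text \<open>Iterating the contiguity relation in \<open>c\<close> multiplies the sum by a quotient of Pochhammer symbols.
  The shifted sum tends to 1 because all its terms but the first are \<open>O(1 / N)\<close>, so the limit of
  the quotients is the value of the sum.\<close>

theorem gauss_summation:
  assumes "a > 0" "b > 0" "c > a + b"
  shows "gauss_term a b c sums (Gamma c * Gamma (c - a - b) / (Gamma (c - a) * Gamma (c - b)))"
proof -
  let ?F = "\<lambda>c. \<Sum>k. gauss_term a b c k"
  let ?r = "\<lambda>N. (pochhammer (c - a) N / pochhammer c N) * (pochhammer (c - b) N / pochhammer (c - a - b) N)"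
  have iter: "?F c = ?r N * ?F (c + N)" for N :: nat
  proof (induction N)
    case (Suc N)
    have "(c + N) * (c + N - a - b) * ?F (c + N) = (c + N - a) * (c + N - b) * ?F (c + N + 1)"
      using assms by (intro gauss_contiguity) auto
    moreover have "(c + N) * (c + N - a - b) \<noteq> 0" using assms by auto
    ultimately have "?F (c + N) = (c + N - a) * (c + N - b) / ((c + N) * (c + N - a - b)) * ?F (c + N + 1)"
      by (metis nonzero_mult_div_cancel_left times_divide_eq_left)
    moreover have eqs: "c - a + N = c + N - a" "c - b + N = c + N - b" "c - a - b + N = c + N - a - b"
      "c + real (Suc N) = c + N + 1" by simp_all
    ultimately show ?case unfolding pochhammer_Suc eqs
      using Suc by (simp only: times_divide_times_eq times_divide_eq_left times_divide_eq_right divide_divide_eq_left mult_ac)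
  qed simp
  have F_bounds: "1 \<le> ?F (c + N) \<and> ?F (c + N) \<le> 1 + c / (c + N) * ?F c" for N :: nat
  proof -
    have sm: "summable (gauss_term a b (c + N))" "summable (gauss_term a b c)"
      using assms by (auto intro!: summable_gauss_term)
    have pos: "gauss_term a b (c + N) k \<ge> 0" "gauss_term a b c k \<ge> 0" for k
      using assms by (auto intro!: less_imp_le gauss_term_pos)
    have split: "?F (c + N) = 1 + (\<Sum>k. gauss_term a b (c + N) (Suc k))"
      using suminf_split_head[OF sm(1)] by simp
    have le: "gauss_term a b (c + N) (Suc k) \<le> c / (c + N) * gauss_term a b c (Suc k)" for k
    proof (induction k)
      case 0
      then show ?case using assms by (simp add: gauss_term_Suc)
    next
      case (Suc k)
      have "(a + real (Suc k)) * (b + real (Suc k)) / ((c + N + real (Suc k)) * (real (Suc k) + 1))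
              \<le> (a + real (Suc k)) * (b + real (Suc k)) / ((c + real (Suc k)) * (real (Suc k) + 1))"
        using assms by (intro divide_left_mono mult_right_mono mult_pos_pos mult_nonneg_nonneg) auto
      from mult_mono[OF Suc this] show ?case
        unfolding gauss_term_Suc[of a b _ "Suc k"] using assms pos by (simp add: mult.assoc)
    qed
    have "(\<Sum>k. gauss_term a b (c + N) (Suc k)) \<le> (\<Sum>k. c / (c + N) * gauss_term a b c (Suc k))"
      using sm by (intro suminf_le le summable_mult) (simp_all add: summable_Suc_iff)
    also have "\<dots> = c / (c + N) * (?F c - 1)"
      using sm suminf_split_head[OF sm(2)] by (subst suminf_mult) (simp_all add: summable_Suc_iff)
    also have "\<dots> \<le> c / (c + N) * ?F c"
      using assms by (intro mult_left_mono) auto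
    finally have "?F (c + N) \<le> 1 + c / (c + N) * ?F c" using split by simp
    moreover have "(\<Sum>k. gauss_term a b (c + N) (Suc k)) \<ge> 0"
      using sm pos by (intro suminf_nonneg) (simp_all add: summable_Suc_iff)
    ultimately show ?thesis using split by simp
  qed
  have "(\<lambda>N. 1 + c / (c + real N) * ?F c) \<longlonglongrightarrow> 1 + 0 * ?F c"
    by (intro tendsto_intros tendsto_divide_0[OF tendsto_const] filterlim_at_top_imp_at_infinity
          filterlim_tendsto_add_at_top[OF tendsto_const] filterlim_real_sequentially)
  then have upper: "(\<lambda>N. 1 + c / (c + real N) * ?F c) \<longlonglongrightarrow> 1" by simp
  have "(\<lambda>N. ?F (c + real N)) \<longlonglongrightarrow> 1"
    by (rule real_tendsto_sandwich[OF _ _ tendsto_const upper])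
       (use F_bounds in \<open>blast intro: always_eventually\<close>)+
  moreover have "?r \<longlonglongrightarrow> Gamma c / Gamma (c - a) * (Gamma (c - a - b) / Gamma (c - b))"
  proof -
    have "(\<lambda>N. (pochhammer (c - a) N / pochhammer c N * real N powr (c - (c - a))) *
        (pochhammer (c - b) N / pochhammer (c - a - b) N * real N powr (c - a - b - (c - b))))
        \<longlonglongrightarrow> Gamma c / Gamma (c - a) * (Gamma (c - a - b) / Gamma (c - b))"
      using assms by (intro tendsto_mult pochhammer_ratio_asymptotics) auto
    moreover have "\<forall>\<^sub>F N in sequentially. (pochhammer (c - a) N / pochhammer c N * real N powr (c - (c - a))) *
        (pochhammer (c - b) N / pochhammer (c - a - b) N * real N powr (c - a - b - (c - b))) = ?r N"
      using eventually_gt_at_top[of 0] by eventually_elim (simp add: powr_minus field_simps)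
    ultimately show ?thesis by (rule Lim_transform_eventually)
  qed
  ultimately have "(\<lambda>N. ?r N * ?F (c + N)) \<longlonglongrightarrow> Gamma c / Gamma (c - a) * (Gamma (c - a - b) / Gamma (c - b)) * 1"
    by (rule tendsto_mult[rotated])
  moreover have "(\<lambda>N. ?r N * ?F (c + N)) = (\<lambda>N. ?F c)"
    by (rule ext) (rule iter [symmetric])
  ultimately have "(\<lambda>N::nat. ?F c) \<longlonglongrightarrow> Gamma c / Gamma (c - a) * (Gamma (c - a - b) / Gamma (c - b)) * 1"
    by simp
  then have "?F c = Gamma c * Gamma (c - a - b) / (Gamma (c - a) * Gamma (c - b))"
    by (simp add: LIMSEQ_const_iff)
  then show ?thesis using summable_sums[OF summable_gauss_term[OF assms]] by simp
qed

section \<open>A Wilf--Zeilberger pair\<close>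

text \<open>The cofactor of \<open>m - w\<close> in \<open>m^3 - w^3\<close>, that is \<open>(m - \<omega> w) (m - \<omega>^2 w)\<close>. It keeps the
  two complex parameters of the hypergeometric sums inside real expressions.\<close>

definition quad :: "real \<Rightarrow> real \<Rightarrow> real" where
  "quad w m = m\<^sup>2 + m * w + w\<^sup>2"

lemma quad_factor: "(m - w) * quad w m = m ^ 3 - w ^ 3"
  by (simp add: quad_def algebra_simps power2_eq_square power3_eq_cube)

lemma quad_pos: "m > 0 \<Longrightarrow> quad w m > 0"
proof -
  assume "m > 0"
  then have "(m + w / 2)\<^sup>2 + 3 / 4 * w\<^sup>2 > 0"
    by (cases "w = 0") (auto intro!: add_nonneg_pos)
  also have "(m + w / 2)\<^sup>2 + 3 / 4 * w\<^sup>2 = quad w m"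
    by (simp add: quad_def power2_eq_square algebra_simps)
  finally show ?thesis .
qed

text \<open>The common hypergeometric factor of both components of the pair. At \<open>j = 0\<close> it equals
  \<open>(cubic_num (w^3) n)\<^sup>2 / cubic_den (w^3) (2 n)\<close>, and at \<open>n = 0\<close> it is the term of the \<open>3F2\<close> series.\<close>

definition wz_weight :: "real \<Rightarrow> nat \<Rightarrow> nat \<Rightarrow> real" where
  "wz_weight w n j = (\<Prod>i<n. quad (- w) (real i + 1 / 2))\<^sup>2 / pochhammer (1 - w) (2 * n)
     * ((pochhammer (1 / 2 + w) (n + j))\<^sup>2 / (\<Prod>i<2 * n + j. quad w (real i + 1)))"

definition wz_F :: "real \<Rightarrow> nat \<Rightarrow> nat \<Rightarrow> real" where
  "wz_F w n j = (2 * real n - w) * wz_weight w n j"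

text \<open>The rational certificate, in the variables \<open>p = n + 1/2\<close> and \<open>s = 2 n + j + 1\<close>. It is what three
  successive shifts, one for each of the parameters \<open>b\<close>, \<open>c\<close> and \<open>d\<close>, remove from the well-poised sum, divided by
  \<open>wz_weight\<close>.\<close>

definition wz_cert :: "real \<Rightarrow> real \<Rightarrow> real \<Rightarrow> real" where
  "wz_cert w p s = (2 * p - 1 - w) + (s - p + w)\<^sup>2 * s / quad w s
      + (s - p + w)\<^sup>2 * (p\<^sup>2 - w\<^sup>2) / (quad w s * (2 * p - w))"

definition wz_G :: "real \<Rightarrow> nat \<Rightarrow> nat \<Rightarrow> real" where
  "wz_G w n j = wz_weight w n j * wz_cert w (real n + 1 / 2) (2 * real n + real j + 1)"

lemma wz_weight_Suc_right:
  "wz_weight w n (Suc j) = wz_weight w n j *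
     ((real n + real j + 1 / 2 + w)\<^sup>2 / quad w (2 * real n + real j + 1))"
  by (simp add: wz_weight_def pochhammer_Suc power_mult_distrib add_ac)

lemma wz_weight_Suc_left:
  "wz_weight w (Suc n) j = wz_weight w n j *
     ((quad (- w) (real n + 1 / 2))\<^sup>2 * (real n + real j + 1 / 2 + w)\<^sup>2 /
      ((2 * real n + 1 - w) * (2 * real n + 2 - w) *
       (quad w (2 * real n + real j + 1) * quad w (2 * real n + real j + 2))))"
proof -
  have "2 * Suc n + j = Suc (Suc (2 * n + j))" "2 * Suc n = Suc (Suc (2 * n))" "Suc n + j = Suc (n + j)"
    by simp_all
  then show ?thesis
    by (simp only: wz_weight_def pochhammer_Suc prod.lessThan_Suc)
       (simp add: power_mult_distrib add_ac diff_add_eq mult_ac)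
qed

text \<open>After cancelling \<open>q\<^sup>2 / quad w s\<close> and clearing denominators, the claim is the polynomial
  identity \<open>key\<close> in \<open>p\<close>, \<open>s\<close> and \<open>w\<close>.\<close>

lemma wz_cert_identity:
  fixes w p s :: real
  assumes "quad w s \<noteq> 0" "quad w (s + 1) \<noteq> 0" "2 * p - w \<noteq> 0"
  defines "q \<equiv> s - p + w"
  shows "(2 * p - 1 - w) - (quad (- w) p)\<^sup>2 * q\<^sup>2 / ((2 * p - w) * (quad w s * quad w (s + 1)))
       = wz_cert w p s - q\<^sup>2 / quad w s * wz_cert w p (s + 1)"
proof -
  have key: "- ((quad (- w) p)\<^sup>2) = (s - (2 * p - 1 - w)) * (2 * p - w) * quad w (s + 1)
      + (p\<^sup>2 - w\<^sup>2) * quad w (s + 1) - (q + 1)\<^sup>2 * ((s + 1) * (2 * p - w) + p\<^sup>2 - w\<^sup>2)"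
    unfolding q_def quad_def by algebra
  \<comment> \<open>Opaque names keep the rational identity small; the definition of \<open>quad\<close> only matters for \<open>key\<close>.\<close>
  define A B where "A = quad w s" and "B = quad w (s + 1)"
  define E where "E = quad (- w) p"
  define d where "d = 2 * p - w"
  have nz: "A \<noteq> 0" "B \<noteq> 0" "d \<noteq> 0" using assms by (auto simp: A_def B_def d_def)
  have q': "s + 1 - p + w = q + 1" by (simp add: q_def)
  have r: "2 * p - 1 - w = d - 1" by (simp add: d_def)
  have key': "- (E\<^sup>2) = (s - (d - 1)) * d * B + (p\<^sup>2 - w\<^sup>2) * B - (q + 1)\<^sup>2 * ((s + 1) * d + p\<^sup>2 - w\<^sup>2)"
    using key unfolding A_def B_def E_def d_def by simp
  have "(d - 1) - E\<^sup>2 * q\<^sup>2 / (d * (A * B)) = (d - 1) + q\<^sup>2 / (d * A * B) * (- (E\<^sup>2))"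
    by (simp add: field_simps)
  also have "\<dots> = (d - 1 + q\<^sup>2 * s / A + q\<^sup>2 * (p\<^sup>2 - w\<^sup>2) / (A * d))
     - q\<^sup>2 / A * (d - 1 + (q + 1)\<^sup>2 * (s + 1) / B + (q + 1)\<^sup>2 * (p\<^sup>2 - w\<^sup>2) / (B * d))"
    unfolding key' using nz by (simp add: divide_simps) (simp add: algebra_simps)
  finally show ?thesis
    unfolding wz_cert_def q' r using q_def A_def B_def E_def d_def by simp
qed

lemma wz_pair:
  assumes w: "- 1 / 4 \<le> w" "w < 0"
  shows "wz_F w n j - wz_F w (Suc n) j = wz_G w n j - wz_G w n (Suc j)"
proof -
  let ?p = "real n + 1 / 2" and ?s = "2 * real n + real j + 1"
  let ?q = "?s - ?p + w"
  have q: "real n + real j + 1 / 2 + w = ?q" "2 * real n + real j + 2 = ?s + 1"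
     "2 * real n + real (Suc j) + 1 = ?s + 1" by simp_all
  have r: "2 * real n - w = 2 * ?p - 1 - w" "2 * real n + 1 - w = 2 * ?p - w" "2 * real (Suc n) - w = 2 * real n + 2 - w"
    by simp_all
  have pos: "quad w ?s > 0" "quad w (?s + 1) > 0" by (intro quad_pos; simp)+
  have d: "2 * ?p - w \<noteq> 0" "2 * real n + 2 - w \<noteq> 0" using w by auto
  have "wz_F w n j - wz_F w (Suc n) j = wz_weight w n j *
     ((2 * ?p - 1 - w) - (quad (- w) ?p)\<^sup>2 * ?q\<^sup>2 / ((2 * ?p - w) * (quad w ?s * quad w (?s + 1))))"
  proof -
    have cancel: "x * (W * (Y / (d * x * Z))) = W * (Y / (d * Z))" if "x \<noteq> 0" for x W Y d Z :: real
      using that by (simp add: field_simps)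
    show ?thesis unfolding wz_F_def wz_weight_Suc_left q r(2,3) cancel[OF d(2)] unfolding r(1)
      by (simp only: right_diff_distrib mult.commute)
  qed
  also have "\<dots> = wz_weight w n j * (wz_cert w ?p ?s - ?q\<^sup>2 / quad w ?s * wz_cert w ?p (?s + 1))"
    using pos d by (subst wz_cert_identity) auto
  also have "\<dots> = wz_G w n j - wz_G w n (Suc j)"
    unfolding wz_G_def wz_weight_Suc_right q by (simp add: algebra_simps)
  finally show ?thesis .
qed

lemma wz_weight_pos:
  assumes "- 1 / 4 \<le> w" "w < 0"
  shows "wz_weight w n j > 0"
  unfolding wz_weight_def using assms
  by (intro mult_pos_pos divide_pos_pos pochhammer_pos prod_pos zero_less_power) (auto intro!: quad_pos)

lemma quad_ge:
  assumes "- 1 / 4 \<le> w" "w < 0" "s \<ge> 1"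
  shows "quad w s \<ge> 3 / 4 * s\<^sup>2"
proof -
  have "s * (- w) \<le> s * (1 / 4)" using assms by (intro mult_left_mono) auto
  moreover have "s * 1 \<le> s * s" using assms by (intro mult_left_mono) auto
  moreover have "w\<^sup>2 \<ge> 0" by simp
  ultimately show ?thesis unfolding quad_def power2_eq_square by argo
qed

text \<open>For large \<open>n\<close> and fixed \<open>j\<close> the ratio of consecutive weights tends to \<open>1/64\<close>. The constant
  \<open>2/9\<close> holds uniformly in \<open>j\<close> and is all that the exchange of limits needs.\<close>

lemma wz_weight_decay:
  assumes w: "- 1 / 4 \<le> w" "w < 0"
  shows "wz_weight w (Suc n) j \<le> 2 / 9 * wz_weight w n j"
proof -
  let ?N = "real n" and ?s = "2 * real n + real j + 1" and ?q = "real n + real j + 1 / 2 + w"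
  let ?e = "quad (- w) (?N + 1 / 2)"
  have "?e \<le> (?N + 1)\<^sup>2"
  proof -
    have "(?N + 1 / 2) * (- w) \<le> (?N + 1 / 2) * (1 / 4)" using w by (intro mult_left_mono) auto
    moreover have "w\<^sup>2 \<le> (1 / 4)\<^sup>2" using w by (intro abs_le_square_iff[THEN iffD1]) auto
    ultimately show ?thesis unfolding quad_def by (simp add: power2_eq_square algebra_simps)
  qed
  moreover have "?e > 0" by (intro quad_pos) auto
  ultimately have e: "?e\<^sup>2 \<le> ((?N + 1)\<^sup>2)\<^sup>2" by (intro power_mono) auto
  have q: "?q\<^sup>2 \<le> ?s\<^sup>2" using w by (intro power_mono) auto
  have D: "quad w ?s \<ge> 3 / 4 * ?s\<^sup>2" using w by (intro quad_ge) auto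
  have "3 / 4 * (2 * ?N + 2)\<^sup>2 \<le> 3 / 4 * (2 * ?N + real j + 2)\<^sup>2"
    by (intro mult_left_mono power_mono) auto
  also have "\<dots> \<le> quad w (2 * ?N + real j + 2)" using w by (intro quad_ge) auto
  finally have D1: "quad w (2 * ?N + real j + 2) \<ge> 3 / 4 * (2 * ?N + 2)\<^sup>2" .
  have "?e\<^sup>2 * ?q\<^sup>2 \<le> ((?N + 1)\<^sup>2)\<^sup>2 * ?s\<^sup>2" using e q by (intro mult_mono) auto
  also have "\<dots> = 1 / 2 * (?N + 1) * (?N + 1) ^ 3 * ?s\<^sup>2 + 1 / 2 * (?N + 1) * (?N + 1) ^ 3 * ?s\<^sup>2"
    by (simp add: power2_eq_square power3_eq_cube)
  also have "\<dots> \<le> 1 / 2 * (2 * ?N + 1) * (?N + 1) ^ 3 * ?s\<^sup>2 + 1 / 2 * (2 * ?N + 1) * (?N + 1) ^ 3 * ?s\<^sup>2"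
    by (intro add_mono mult_right_mono) auto
  also have "\<dots> = 2 / 9 * ((2 * ?N + 1) * (2 * ?N + 2) * ((3 / 4 * ?s\<^sup>2) * (3 / 4 * (2 * ?N + 2)\<^sup>2)))"
    by (simp add: power2_eq_square power3_eq_cube field_simps)
  also have "\<dots> \<le> 2 / 9 * ((2 * ?N + 1 - w) * (2 * ?N + 2 - w) * (quad w ?s * quad w (2 * ?N + real j + 2)))"
    using w D D1 by (intro mult_left_mono mult_mono) (auto intro!: mult_nonneg_nonneg less_imp_le[OF quad_pos])
  finally have le: "?e\<^sup>2 * ?q\<^sup>2 \<le> \<dots>" .
  have "(2 * ?N + 1 - w) * (2 * ?N + 2 - w) * (quad w ?s * quad w (2 * ?N + real j + 2)) > 0"
    using w by (intro mult_pos_pos quad_pos) auto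
  then have "?e\<^sup>2 * ?q\<^sup>2 / ((2 * ?N + 1 - w) * (2 * ?N + 2 - w) * (quad w ?s * quad w (2 * ?N + real j + 2))) \<le> 2 / 9"
    using le by (simp add: pos_divide_le_eq)
  from mult_left_mono[OF this less_imp_le[OF wz_weight_pos[OF w, of n j]]] show ?thesis
    unfolding wz_weight_Suc_left by (simp only: mult.commute)
qed

lemma wz_weight_le:
  assumes w: "- 1 / 4 \<le> w" "w < 0"
  shows "wz_weight w n j \<le> (2 / 9) ^ n * wz_weight w 0 j"
proof (induction n)
  case (Suc n)
  then show ?case using wz_weight_decay[OF w, of n j] by simp
qed simp

text \<open>The ratio between the \<open>3F2\<close> term and the term of the Gauss series obtained by
  replacing \<open>quad w m\<close> by \<open>m (m + w)\<close>, two quantities that differ by \<open>w\<^sup>2\<close>.\<close>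

definition damping :: "real \<Rightarrow> nat \<Rightarrow> real" where
  "damping w k = (\<Prod>i<k. (real i + 1) * (real i + 1 + w) / quad w (real i + 1))"

lemma pochhammer_times_fact:
  "pochhammer (1 + w) k * fact k = (\<Prod>i<k. (real i + 1) * (real i + 1 + w))"
  unfolding pochhammer_prod pochhammer_fact prod.distrib
  by (simp add: lessThan_atLeast0 add_ac)

lemma wz_weight_eq_damped_gauss_term:
  assumes w: "- 1 / 4 \<le> w" "w < 0"
  shows "wz_weight w 0 k = gauss_term (1 / 2 + w) (1 / 2 + w) (1 + w) k * damping w k"
proof -
  have "pochhammer (1 + w) k * fact k > 0" using w by (intro mult_pos_pos pochhammer_pos) auto
  then have "(\<Prod>i<k. (real i + 1) * (real i + 1 + w)) > 0"
    "gauss_term (1 / 2 + w) (1 / 2 + w) (1 + w) k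
       = (pochhammer (1 / 2 + w) k)\<^sup>2 / (\<Prod>i<k. (real i + 1) * (real i + 1 + w))"
    by (simp_all only: pochhammer_times_fact gauss_term_def power2_eq_square)
  moreover have "damping w k = (\<Prod>i<k. (real i + 1) * (real i + 1 + w)) / (\<Prod>i<k. quad w (real i + 1))"
    unfolding damping_def by (rule prod_dividef)
  ultimately show ?thesis
    by (simp del: prod_zero_iff add: wz_weight_def)
qed

lemma damping_pos: "- 1 / 4 \<le> w \<Longrightarrow> damping w k > 0"
  unfolding damping_def by (intro prod_pos divide_pos_pos mult_pos_pos ballI quad_pos) auto

lemma damping_le_1: "- 1 / 4 \<le> w \<Longrightarrow> damping w k \<le> 1"
  unfolding damping_def
proof (intro prod_le_1 conjI)
  fix i assume w: "- 1 / 4 \<le> w"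
  have "quad w (real i + 1) > 0" by (intro quad_pos) auto
  then show "(real i + 1) * (real i + 1 + w) / quad w (real i + 1) \<le> 1"
    by (simp add: quad_def power2_eq_square algebra_simps)
  show "(real i + 1) * (real i + 1 + w) / quad w (real i + 1) \<ge> 0"
    using w by (intro divide_nonneg_pos quad_pos mult_nonneg_nonneg) auto
qed

lemma wz_weight_0_le:
  assumes w: "- 1 / 4 \<le> w" "w < 0"
  shows "wz_weight w 0 k \<le> gauss_term (1 / 2 + w) (1 / 2 + w) (1 + w) k"
  using damping_le_1[of w k] gauss_term_pos[of "1 / 2 + w" "1 / 2 + w" "1 + w" k] w
  by (simp add: wz_weight_eq_damped_gauss_term)

lemma summable_wz_weight:
  assumes w: "- 1 / 4 \<le> w" "w < 0"
  shows "summable (wz_weight w n)"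
proof (rule summable_comparison_test')
  show "summable (\<lambda>j. (2 / 9) ^ n * gauss_term (1 / 2 + w) (1 / 2 + w) (1 + w) j)"
    using w by (intro summable_mult summable_gauss_term) auto
  show "norm (wz_weight w n j) \<le> (2 / 9) ^ n * gauss_term (1 / 2 + w) (1 / 2 + w) (1 + w) j" for j
  proof -
    have "wz_weight w n j \<le> (2 / 9) ^ n * wz_weight w 0 j" by (rule wz_weight_le[OF w])
    also have "\<dots> \<le> (2 / 9) ^ n * gauss_term (1 / 2 + w) (1 / 2 + w) (1 + w) j"
      by (intro mult_left_mono wz_weight_0_le w) auto
    finally show ?thesis using wz_weight_pos[OF w, of n j] by simp
  qed
qed

lemma wz_cert_bounds:
  assumes w: "- 1 / 4 \<le> w" "w < 0" and s: "p \<ge> 1 / 2" "s \<ge> 2 * p"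
  shows "0 \<le> wz_cert w p s" "wz_cert w p s \<le> 2 * p + 4 / 3 * s + 4 / 3 * p\<^sup>2"
proof -
  have D: "quad w s \<ge> 3 / 4 * s\<^sup>2" using assms by (intro quad_ge) auto
  have D0: "quad w s > 0" using s by (intro quad_pos) auto
  have q: "(s - p + w)\<^sup>2 \<le> s\<^sup>2" using assms by (intro power_mono) auto
  then have "(s - p + w)\<^sup>2 \<le> 4 / 3 * quad w s" using D by argo
  then have Q: "(s - p + w)\<^sup>2 / quad w s \<le> 4 / 3" using D0 by (simp add: pos_divide_le_eq)
  have Q0: "(s - p + w)\<^sup>2 / quad w s \<ge> 0" using D0 by simp
  have W: "w\<^sup>2 \<le> p\<^sup>2" using w s by (intro abs_le_square_iff[THEN iffD1]) auto
  have d: "2 * p - w \<ge> 1" using w s by auto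
  have P: "(p\<^sup>2 - w\<^sup>2) / (2 * p - w) \<le> p\<^sup>2"
  proof -
    have "(p\<^sup>2 - w\<^sup>2) / (2 * p - w) \<le> (p\<^sup>2 - w\<^sup>2) / 1" using W d by (intro divide_left_mono) auto
    then show ?thesis by (smt (verit) zero_le_power2 div_by_1)
  qed
  have P0: "(p\<^sup>2 - w\<^sup>2) / (2 * p - w) \<ge> 0" using W d by simp
  have eq: "wz_cert w p s = (2 * p - 1 - w) + (s - p + w)\<^sup>2 / quad w s * s
      + (s - p + w)\<^sup>2 / quad w s * ((p\<^sup>2 - w\<^sup>2) / (2 * p - w))"
    by (simp add: wz_cert_def)
  show "0 \<le> wz_cert w p s" unfolding eq using w s Q0 P0
    by (intro add_nonneg_nonneg mult_nonneg_nonneg) auto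
  have "(s - p + w)\<^sup>2 / quad w s * s \<le> 4 / 3 * s" using Q s by (intro mult_right_mono) auto
  moreover have "(s - p + w)\<^sup>2 / quad w s * ((p\<^sup>2 - w\<^sup>2) / (2 * p - w)) \<le> 4 / 3 * p\<^sup>2"
    using Q P Q0 P0 by (intro mult_mono) auto
  ultimately show "wz_cert w p s \<le> 2 * p + 4 / 3 * s + 4 / 3 * p\<^sup>2" unfolding eq using w by linarith
qed

text \<open>The certificate grows linearly in \<open>j\<close>, and \<open>j\<close> times the term of a convergent Gauss
  series tends to 0.\<close>

lemma wz_G_tendsto_0:
  assumes w: "- 1 / 4 \<le> w" "w < 0"
  shows "(\<lambda>j. wz_G w n j) \<longlonglongrightarrow> 0"
proof -
  let ?g = "gauss_term (1 / 2 + w) (1 / 2 + w) (1 + w)"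
  let ?K = "2 * (real n + 1 / 2) + 4 / 3 * (2 * real n + 1) + 4 / 3 * (real n + 1 / 2)\<^sup>2"
  have "(\<lambda>j. (2 / 9) ^ n * (?K * ?g j + 4 / 3 * (real j * ?g j))) \<longlonglongrightarrow> (2 / 9) ^ n * (?K * 0 + 4 / 3 * 0)"
    using w by (intro tendsto_intros gauss_term_tendsto_0 summable_LIMSEQ_zero summable_gauss_term) auto
  then have lim: "(\<lambda>j. (2 / 9) ^ n * (?K * ?g j + 4 / 3 * (real j * ?g j))) \<longlonglongrightarrow> 0" by simp
  show ?thesis
  proof (rule real_tendsto_sandwich[OF _ _ tendsto_const lim]; intro always_eventually allI)
    fix j
    let ?c = "wz_cert w (real n + 1 / 2) (2 * real n + real j + 1)"
    have c: "0 \<le> ?c" "?c \<le> ?K + 4 / 3 * real j"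
    proof -
      have "real n + 1 / 2 \<ge> 1 / 2" "2 * real n + real j + 1 \<ge> 2 * (real n + 1 / 2)" by simp_all
      note b = wz_cert_bounds[OF w this]
      show "0 \<le> ?c" by (rule b(1))
      show "?c \<le> ?K + 4 / 3 * real j" by (rule order_trans[OF b(2)]) (simp add: field_simps)
    qed
    have g: "?g j > 0" using w by (intro gauss_term_pos) auto
    have "wz_weight w n j \<le> (2 / 9) ^ n * wz_weight w 0 j" by (rule wz_weight_le[OF w])
    also have "\<dots> \<le> (2 / 9) ^ n * ?g j"
      by (intro mult_left_mono wz_weight_0_le w) auto
    finally have W: "wz_weight w n j \<le> (2 / 9) ^ n * ?g j" .
    have "wz_G w n j \<le> ((2 / 9) ^ n * ?g j) * (?K + 4 / 3 * real j)"
      unfolding wz_G_def using W c g by (intro mult_mono) auto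
    then show "wz_G w n j \<le> (2 / 9) ^ n * (?K * ?g j + 4 / 3 * (real j * ?g j))"
      by (simp add: algebra_simps)
    show "0 \<le> wz_G w n j" unfolding wz_G_def using c wz_weight_pos[OF w, of n j] by simp
  qed
qed

text \<open>Summing the pair relation over \<open>j\<close> makes \<open>wz_G w n 0\<close> a difference of consecutive row sums of
  \<open>wz_F\<close>. These decay exponentially in \<open>n\<close>, so the sum telescopes to the row sum at \<open>n = 0\<close>.\<close>

theorem wz_boundary_sums:
  assumes w: "- 1 / 4 \<le> w" "w < 0"
  shows "(\<lambda>n. wz_G w n 0) sums (- w * (\<Sum>j. wz_weight w 0 j))"
proof -
  let ?\<Phi> = "\<lambda>n. \<Sum>j. wz_F w n j"
  have F: "?\<Phi> n = (2 * real n - w) * (\<Sum>j. wz_weight w n j)" for n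
    unfolding wz_F_def by (rule suminf_mult) (rule summable_wz_weight[OF w])
  have smF: "summable (wz_F w n)" for n
    unfolding wz_F_def by (intro summable_mult summable_wz_weight w)
  have step: "?\<Phi> n - ?\<Phi> (Suc n) = wz_G w n 0" for n
  proof -
    have "(\<lambda>j. wz_G w n j - wz_G w n (Suc j)) sums (wz_G w n 0 - 0)"
      by (rule telescope_sums') (rule wz_G_tendsto_0[OF w])
    moreover have "(\<lambda>j. wz_F w n j - wz_F w (Suc n) j) sums (?\<Phi> n - ?\<Phi> (Suc n))"
      by (intro sums_diff summable_sums smF)
    ultimately show ?thesis unfolding wz_pair[OF w] using sums_unique2 by fastforce
  qed
  have "(\<lambda>n. ?\<Phi> n) \<longlonglongrightarrow> 0"
  proof (rule real_tendsto_sandwich[OF _ _ tendsto_const])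
    let ?S = "\<Sum>j. wz_weight w 0 j"
    have "(\<lambda>n. (2 * (real n * (2 / 9) ^ n) - w * (2 / 9) ^ n) * ?S) \<longlonglongrightarrow> (2 * 0 - w * 0) * ?S"
      by (intro tendsto_intros powser_times_n_limit_0) auto
    then show "(\<lambda>n. (2 * (real n * (2 / 9) ^ n) - w * (2 / 9) ^ n) * ?S) \<longlonglongrightarrow> 0" by simp
    show "\<forall>\<^sub>F n in sequentially. 0 \<le> ?\<Phi> n"
      unfolding F using w wz_weight_pos[OF w]
      by (intro always_eventually allI mult_nonneg_nonneg suminf_nonneg summable_wz_weight) (auto intro: less_imp_le)
    show "\<forall>\<^sub>F n in sequentially. ?\<Phi> n \<le> (2 * (real n * (2 / 9) ^ n) - w * (2 / 9) ^ n) * ?S"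
    proof (intro always_eventually allI)
      fix n
      have "(\<Sum>j. wz_weight w n j) \<le> (\<Sum>j. (2 / 9) ^ n * wz_weight w 0 j)"
        by (intro suminf_le wz_weight_le summable_mult summable_wz_weight w)
      also have "\<dots> = (2 / 9) ^ n * ?S" by (rule suminf_mult) (rule summable_wz_weight[OF w])
      finally have "?\<Phi> n \<le> (2 * real n - w) * ((2 / 9) ^ n * ?S)"
        unfolding F using w by (intro mult_left_mono) auto
      then show "?\<Phi> n \<le> (2 * (real n * (2 / 9) ^ n) - w * (2 / 9) ^ n) * ?S"
        by (simp add: algebra_simps)
    qed
  qed
  then have "(\<lambda>n. ?\<Phi> n - ?\<Phi> (Suc n)) sums (?\<Phi> 0 - 0)" by (rule telescope_sums')
  then show ?thesis unfolding step F[of 0] by simp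
qed

definition cubic_num :: "real \<Rightarrow> nat \<Rightarrow> real" where
  "cubic_num y n = (\<Prod>i<n. (real i + 1 / 2) ^ 3 + y)"

definition cubic_den :: "real \<Rightarrow> nat \<Rightarrow> real" where
  "cubic_den y n = (\<Prod>i<n. (real i + 1) ^ 3 - y)"

text \<open>At \<open>y = 0\<close> this is the term of Ramanujan's series for \<open>16 / pi\<close>. The last factor is 16 times
  the certificate at \<open>j = 0\<close>, which depends on \<open>w\<close> only through \<open>y = w^3\<close>.\<close>

definition fast_term :: "real \<Rightarrow> nat \<Rightarrow> real" where
  "fast_term y n = (cubic_num y n)\<^sup>2 / cubic_den y (2 * n) *
     (42 * real n + 5 - 27 * y * (2 * real n + 1) / ((2 * real n + 1) ^ 3 - y))"

lemma cubic_den_factor: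
  "cubic_den (w ^ 3) m = pochhammer (1 - w) m * (\<Prod>i<m. quad w (real i + 1))"
  unfolding cubic_den_def pochhammer_prod lessThan_atLeast0 prod.distrib [symmetric] quad_factor [symmetric]
  by (intro prod.cong refl arg_cong2[where f = "(*)"]) auto

lemma cubic_num_factor:
  "cubic_num (w ^ 3) m = pochhammer (1 / 2 + w) m * (\<Prod>i<m. quad (- w) (real i + 1 / 2))"
proof -
  have "(real i + 1 / 2) ^ 3 + w ^ 3 = (1 / 2 + w + real i) * quad (- w) (real i + 1 / 2)" for i
    using quad_factor[of "real i + 1 / 2" "- w"] by (simp add: add_ac)
  then show ?thesis
    by (simp add: cubic_num_def pochhammer_prod lessThan_atLeast0 prod.distrib [symmetric])
qed

lemma wz_G_eq_fast_term:
  assumes w: "- 1 / 4 \<le> w" "w < 0"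
  shows "wz_G w n 0 = fast_term (w ^ 3) n / 16"
proof -
  have W: "wz_weight w n 0 = (cubic_num (w ^ 3) n)\<^sup>2 / cubic_den (w ^ 3) (2 * n)"
    by (simp add: wz_weight_def cubic_num_factor cubic_den_factor power_mult_distrib)
  define s where "s = 2 * real n + 1"
  have n: "real n = (s - 1) / 2" by (simp add: s_def)
  have D: "quad w s > 0" unfolding s_def by (intro quad_pos) auto
  have d: "s - w \<noteq> 0" using w by (simp add: s_def)
  have "wz_cert w (real n + 1 / 2) (2 * real n + real 0 + 1) = wz_cert w (s / 2) s"
    by (simp add: s_def add_divide_distrib)
  also have "\<dots> = (s - 1 - w) + (s / 2 + w)\<^sup>2 * s / quad w s + (s / 2 + w)\<^sup>2 * (s\<^sup>2 / 4 - w\<^sup>2) / (quad w s * (s - w))"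
    by (simp add: wz_cert_def power_divide)
  also have "\<dots> = (21 * s - 16 - 27 * w ^ 3 * s / ((s - w) * quad w s)) / 16"
    using D d by (simp add: divide_simps) (simp add: quad_def algebra_simps power2_eq_square power3_eq_cube)
  also have "\<dots> = (42 * real n + 5 - 27 * w ^ 3 * (2 * real n + 1) / ((2 * real n + 1) ^ 3 - w ^ 3)) / 16"
    unfolding quad_factor by (simp add: s_def)
  finally have cert: "wz_cert w (real n + 1 / 2) (2 * real n + real 0 + 1) = \<dots>" .
  show ?thesis unfolding wz_G_def W fast_term_def cert by simp
qed

theorem fast_sums_damped:
  assumes w: "- 1 / 4 \<le> w" "w < 0"
  shows "fast_term (w ^ 3) sums (16 * (- w * (\<Sum>k. gauss_term (1 / 2 + w) (1 / 2 + w) (1 + w) k * damping w k)))"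
  using sums_mult[OF wz_boundary_sums[OF w], of 16]
  by (simp add: wz_G_eq_fast_term[OF w] wz_weight_eq_damped_gauss_term[OF w])

section \<open>A series for the integral of \<open>x\<^sup>2 / sin x\<close>\<close>

definition wallis_ratio :: "nat \<Rightarrow> real" where
  "wallis_ratio n = pochhammer (1 / 2) n / fact n"

lemma wallis_ratio_0 [simp]: "wallis_ratio 0 = 1"
  by (simp add: wallis_ratio_def)

lemma wallis_ratio_pos: "wallis_ratio n > 0"
  by (simp add: wallis_ratio_def pochhammer_pos)

lemma wallis_ratio_Suc: "wallis_ratio (Suc n) = wallis_ratio n * ((2 * real n + 1) / (2 * real n + 2))"
  by (simp add: wallis_ratio_def pochhammer_Suc field_simps)

lemma zeta_3_sums: "(\<lambda>k. 1 / (real k + 1) ^ 3) sums (zeta 3 :: real)"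
proof -
  have "summable (\<lambda>k. inverse (real (Suc k) ^ 3))"
    using inverse_power_summable[of 3, where ?'a = real] by (subst summable_Suc_iff) simp
  then have "summable (\<lambda>k. 1 / (real k + 1) ^ 3)" by (simp add: inverse_eq_divide add_ac)
  moreover have "(\<lambda>k. of_nat (Suc k) powr (- 3 :: real)) = (\<lambda>k. 1 / (real k + 1) ^ 3)"
  proof
    fix k
    have "real (Suc k) powr (- 3) = inverse (real (Suc k) powr real 3)" by (simp add: powr_minus)
    also have "\<dots> = 1 / (real k + 1) ^ 3" by (subst powr_realpow) (simp_all add: field_simps)
    finally show "of_nat (Suc k) powr (- 3 :: real) = 1 / (real k + 1) ^ 3" by simp
  qed
  ultimately show ?thesis unfolding zeta_def by (simp add: summable_sums)
qed

text \<open>The even terms of the zeta series contribute one eighth of the total.\<close>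

lemma zeta_3_odd_sums: "(\<lambda>j. 1 / (2 * real j + 1) ^ 3) sums (7 / 8 * zeta 3)"
proof -
  have "(\<lambda>n. \<Sum>k\<in>{n * 2..<n * 2 + 2}. 1 / (real k + 1) ^ 3) sums zeta 3"
    by (rule sums_group[OF zeta_3_sums]) simp
  moreover have "(\<Sum>k\<in>{n * 2..<n * 2 + 2}. 1 / (real k + 1) ^ 3)
      = 1 / (2 * real n + 1) ^ 3 + 1 / 8 * (1 / (real n + 1) ^ 3)" for n
  proof -
    have "{n * 2..<n * 2 + 2} = {2 * n, Suc (2 * n)}" by auto
    moreover have "(2 * real n + 2) ^ 3 = 8 * (real n + 1) ^ 3"
      by (simp add: power3_eq_cube algebra_simps)
    ultimately show ?thesis by (simp add: add_ac)
  qed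
  ultimately have "(\<lambda>n. 1 / (2 * real n + 1) ^ 3 + 1 / 8 * (1 / (real n + 1) ^ 3)) sums zeta 3" by simp
  from sums_diff[OF this sums_mult[OF zeta_3_sums, of "1 / 8"]] show ?thesis by simp
qed

lemma catalan_sums: "(\<lambda>j. (- 1) ^ j / (2 * real j + 1)\<^sup>2) sums catalan_const"
proof -
  have "summable (\<lambda>j. (- 1) ^ j / (2 * real j + 1)\<^sup>2)"
  proof (rule summable_comparison_test')
    show "summable (\<lambda>k. 1 / (real k + 1)\<^sup>2)"
      using inverse_squares_sums by (simp add: sums_iff add_ac)
    show "norm ((- 1) ^ j / (2 * real j + 1)\<^sup>2) \<le> 1 / (real j + 1)\<^sup>2" for j
      by (auto simp: power_abs intro!: divide_left_mono power_mono)
  qed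
  then show ?thesis unfolding catalan_const_def by (simp add: summable_sums add_ac)
qed

lemma sin_power_deriv:
  "((\<lambda>x. sin x ^ (m + 1)) has_real_derivative (real m + 1) * sin x ^ m * cos x) (at x within A)"
proof -
  have "(sin has_real_derivative cos x) (at x within A)"
    by (rule has_field_derivative_at_within) (rule DERIV_sin)
  from DERIV_power_Suc[OF this, of m] show ?thesis by (simp add: mult_ac add_ac)
qed

lemma sin_power_cos_deriv:
  "((\<lambda>x. sin x ^ (m + 1) * cos x) has_real_derivative (real m + 1) * sin x ^ m - (real m + 2) * sin x ^ (m + 2)) (at x within A)"
proof -
  have "(cos has_real_derivative - sin x) (at x within A)"
    by (rule has_field_derivative_at_within) (rule DERIV_cos)
  from DERIV_mult[OF sin_power_deriv[of m] this]
  have "((\<lambda>x. sin x ^ (m + 1) * cos x) has_real_derivative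
     (real m + 1) * sin x ^ m * (cos x)\<^sup>2 - sin x ^ (m + 2)) (at x within A)"
    by (simp add: power2_eq_square mult_ac)
  also have "(real m + 1) * sin x ^ m * (cos x)\<^sup>2 - sin x ^ (m + 2)
     = (real m + 1) * sin x ^ m - (real m + 2) * sin x ^ (m + 2)"
    unfolding cos_squared_eq by (simp add: power_add power2_eq_square algebra_simps)
  finally show ?thesis .
qed

text \<open>The Wallis recursion; the integrand is minus the derivative of \<open>sin x ^ (m + 1) * cos x\<close>, which vanishes at
  both ends also for \<open>m = 0\<close>.\<close>

lemma sin_power_reduction:
  "((\<lambda>x. (real m + 2) * sin x ^ (m + 2) - (real m + 1) * sin x ^ m) has_integral 0) {0..pi / 2}"
proof -
  have "((\<lambda>x. (real m + 1) * sin x ^ m - (real m + 2) * sin x ^ (m + 2)) has_integral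
           sin (pi / 2) ^ (m + 1) * cos (pi / 2) - sin 0 ^ (m + 1) * cos 0) {0..pi / 2}"
    by (rule fundamental_theorem_of_calculus)
       (simp_all only: sin_power_cos_deriv pi_half_ge_zero flip: has_real_derivative_iff_has_vector_derivative)
  from has_integral_neg[OF this] show ?thesis by simp
qed

lemma has_integral_sin_odd_power:
  "((\<lambda>x. sin x ^ (2 * n + 1)) has_integral 1 / (2 * (real n + 1) * wallis_ratio (Suc n))) {0..pi / 2}"
proof (induction n)
  case 0
  have "((\<lambda>x. sin x) has_integral - cos (pi / 2) - (- cos 0)) {0..pi / 2}"
    by (rule fundamental_theorem_of_calculus)
       (auto intro!: derivative_eq_intros simp flip: has_real_derivative_iff_has_vector_derivative)
  then show ?case by (simp add: wallis_ratio_Suc)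
next
  case (Suc n)
  let ?I = "1 / (2 * (real n + 1) * wallis_ratio (Suc n))"
  have "((\<lambda>x. ((2 * real n + 3) * sin x ^ (2 * n + 3) - (2 * real n + 2) * sin x ^ (2 * n + 1)) +
     (2 * real n + 2) * sin x ^ (2 * n + 1)) has_integral 0 + (2 * real n + 2) * ?I) {0..pi / 2}"
    using sin_power_reduction[of "2 * n + 1"] Suc
    by (intro has_integral_add has_integral_mult_right) (auto simp: add_ac numeral_3_eq_3)
  then have "((\<lambda>x. (2 * real n + 3) * sin x ^ (2 * n + 3)) has_integral (2 * real n + 2) * ?I) {0..pi / 2}"
    by simp
  from has_integral_mult_right[OF this, of "1 / (2 * real n + 3)"]
  have "((\<lambda>x. sin x ^ (2 * n + 3)) has_integral 1 / (2 * real n + 3) * ((2 * real n + 2) * ?I)) {0..pi / 2}"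
  proof -
    have "1 / (2 * real n + 3) * ((2 * real n + 3) * z) = z" for z
      using of_nat_0_le_iff[of n] by (simp add: add_nonneg_eq_0_iff)
    with \<open>((\<lambda>x. 1 / _ * _) has_integral _) _\<close> show ?thesis by (simp only:)
  qed
  moreover have "1 / (2 * real n + 3) * ((2 * real n + 2) * ?I)
      = 1 / (2 * (real (Suc n) + 1) * wallis_ratio (Suc (Suc n)))"
    using wallis_ratio_pos[of "Suc n"] by (simp add: wallis_ratio_Suc[of "Suc n"] divide_simps)
  moreover have "2 * Suc n + 1 = 2 * n + 3" by simp
  ultimately show ?case by (simp only:)
qed

text \<open>Jordan's inequality: the sine is concave, so it lies above its chord.\<close>

lemma jordan_sin: "0 \<le> x \<Longrightarrow> x \<le> pi / 2 \<Longrightarrow> x \<le> pi / 2 * sin x"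
proof -
  assume x: "0 \<le> x" "x \<le> pi / 2"
  have "convex_on {0..pi / 2} (\<lambda>x. - sin x)"
  proof (rule f''_ge0_imp_convex)
    show "((\<lambda>x. - sin x) has_real_derivative - cos x) (at x)" for x
      by (auto intro!: derivative_eq_intros)
    show "((\<lambda>x. - cos x) has_real_derivative sin x) (at x)" for x :: real
      by (auto intro!: derivative_eq_intros)
    show "0 \<le> sin x" if "x \<in> {0..pi / 2}" for x
      using that by (auto intro!: sin_ge_zero)
  qed auto
  from convex_onD_Icc'[OF this, of x] x show ?thesis
    by (simp add: field_simps)
qed

text \<open>The remainder of the expansion
  \<open>arcsin\<^sup>2 z = \<Sum> z^(2 n) / (2 n\<^sup>2 c_n)\<close> at \<open>z = sin x\<close>, where \<open>c_n\<close> is the Wallis ratio. The index is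
  shifted so that the sum starts with \<open>n = 1\<close>.\<close>

definition arcsin_rem :: "nat \<Rightarrow> real \<Rightarrow> real" where
  "arcsin_rem N x = x\<^sup>2 - (\<Sum>n<N. sin x ^ (2 * n + 2) / (2 * (real n + 1)\<^sup>2 * wallis_ratio (Suc n)))"

definition arcsin_rem' :: "nat \<Rightarrow> real \<Rightarrow> real" where
  "arcsin_rem' N x = 2 * x - (\<Sum>n<N. sin x ^ (2 * n + 1) * cos x / ((real n + 1) * wallis_ratio (Suc n)))"

lemma arcsin_rem_deriv: "(arcsin_rem N has_real_derivative arcsin_rem' N x) (at x within A)"
proof -
  have deriv: "((\<lambda>x. sin x ^ (2 * n + 2) / (2 * (real n + 1)\<^sup>2 * wallis_ratio (Suc n))) has_real_derivative
     sin x ^ (2 * n + 1) * cos x / ((real n + 1) * wallis_ratio (Suc n))) (at x within A)" for n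
  proof -
    have "((\<lambda>x. sin x ^ (2 * n + 2) / (2 * (real n + 1)\<^sup>2 * wallis_ratio (Suc n))) has_real_derivative
       (2 * real n + 2) * (sin x ^ (2 * n + 1) * cos x) / (2 * (real n + 1)\<^sup>2 * wallis_ratio (Suc n))) (at x within A)"
      using sin_power_deriv[of "2 * n + 1" x A]
      by (intro DERIV_cdivide) (simp add: mult_ac add_ac)
    also have "(2 * real n + 2) * (sin x ^ (2 * n + 1) * cos x) / (2 * (real n + 1)\<^sup>2 * wallis_ratio (Suc n))
        = sin x ^ (2 * n + 1) * cos x / ((real n + 1) * wallis_ratio (Suc n))"
      using wallis_ratio_pos[of "Suc n"] by (simp add: divide_simps) (simp add: algebra_simps power2_eq_square)
    finally show ?thesis .
  qed
  show ?thesis unfolding arcsin_rem_def arcsin_rem'_def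
    by (rule derivative_eq_intros deriv refl | simp)+
qed

text \<open>The second derivatives of the terms telescope, and only the last one survives. In
  particular the remainder is convex.\<close>

lemma arcsin_rem'_deriv: "(arcsin_rem' N has_real_derivative 2 / wallis_ratio N * sin x ^ (2 * N)) (at x within A)"
proof (induction N)
  case 0
  then show ?case unfolding arcsin_rem'_def by (auto intro!: derivative_eq_intros)
next
  case (Suc N)
  let ?k = "(real N + 1) * wallis_ratio (Suc N)"
  have eq: "arcsin_rem' (Suc N) = (\<lambda>x. arcsin_rem' N x - sin x ^ (2 * N + 1) * cos x / ?k)"
    by (simp add: fun_eq_iff arcsin_rem'_def)
  have d: "((\<lambda>x. sin x ^ (2 * N + 1) * cos x) has_real_derivative
     (2 * real N + 1) * sin x ^ (2 * N) - (2 * real N + 2) * sin x ^ (2 * N + 2)) (at x within A)"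
    using sin_power_cos_deriv[of "2 * N" x A] by simp
  have k: "?k = wallis_ratio N * (2 * real N + 1) / 2"
    by (simp add: wallis_ratio_Suc field_simps)
  have "2 / wallis_ratio N * sin x ^ (2 * N) -
     ((2 * real N + 1) * sin x ^ (2 * N) - (2 * real N + 2) * sin x ^ (2 * N + 2)) / ?k
     = 2 / wallis_ratio (Suc N) * sin x ^ (2 * Suc N)"
    unfolding k using wallis_ratio_pos[of N]
    by (simp add: wallis_ratio_Suc divide_simps)
  then show ?case unfolding eq using DERIV_diff[OF Suc DERIV_cdivide[OF d, of ?k]] by simp
qed

lemma arcsin_rem_convex: "convex_on UNIV (arcsin_rem N)"
  by (rule f''_ge0_imp_convex[OF _ arcsin_rem_deriv arcsin_rem'_deriv])
     (auto intro!: mult_nonneg_nonneg simp: less_imp_le[OF wallis_ratio_pos] power_mult)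

lemma arcsin_rem_0 [simp]: "arcsin_rem N 0 = 0" and arcsin_rem'_0 [simp]: "arcsin_rem' N 0 = 0"
  by (simp_all add: arcsin_rem_def arcsin_rem'_def)

lemma arcsin_rem_nonneg: "arcsin_rem N x \<ge> 0"
proof -
  have "arcsin_rem N x - arcsin_rem N 0 \<ge> arcsin_rem' N 0 * (x - 0)"
    by (rule convex_on_imp_above_tangent[OF arcsin_rem_convex _ _ _ arcsin_rem_deriv]) auto
  then show ?thesis by simp
qed

text \<open>By convexity the remainder lies below its chord over \<open>[0, pi/2]\<close>, which Jordan's
  inequality compares with the sine. Division by \<open>sin x\<close> therefore costs nothing.\<close>

lemma arcsin_rem_le:
  assumes "0 \<le> x" "x \<le> pi / 2"
  shows "arcsin_rem N x \<le> arcsin_rem N (pi / 2) * sin x"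
proof -
  have "convex_on {0..pi / 2} (arcsin_rem N)"
    by (rule convex_on_subset[OF arcsin_rem_convex]) auto
  from convex_onD_Icc'[OF this, of x] assms
  have "arcsin_rem N x \<le> arcsin_rem N (pi / 2) / (pi / 2) * x" by simp
  also have "\<dots> \<le> arcsin_rem N (pi / 2) / (pi / 2) * (pi / 2 * sin x)"
    using jordan_sin[OF assms] arcsin_rem_nonneg[of N "pi / 2"] by (intro mult_left_mono) auto
  finally show ?thesis by simp
qed

text \<open>Taylor's formula with integral remainder gives the left-hand side as the integral of
  \<open>(pi/2 - x)\<close> times the second derivative. Bounding \<open>pi/2 - x\<close> by \<open>(pi/2) cos x\<close> makes the
  integral elementary.\<close>

lemma arcsin_rem_half_pi_le: "arcsin_rem N (pi / 2) \<le> pi / (wallis_ratio N * (2 * real N + 1))"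
proof -
  let ?c = "2 / wallis_ratio N"
  have "((\<lambda>x. (pi / 2 - x) * (?c * sin x ^ (2 * N))) has_integral
     ((pi / 2 - pi / 2) * arcsin_rem' N (pi / 2) + arcsin_rem N (pi / 2)) -
     ((pi / 2 - 0) * arcsin_rem' N 0 + arcsin_rem N 0)) {0..pi / 2}"
  proof (rule fundamental_theorem_of_calculus)
    fix x :: real
    show "((\<lambda>x. (pi / 2 - x) * arcsin_rem' N x + arcsin_rem N x) has_vector_derivative
             (pi / 2 - x) * (?c * sin x ^ (2 * N))) (at x within {0..pi / 2})"
      unfolding has_real_derivative_iff_has_vector_derivative [symmetric]
      by (rule derivative_eq_intros arcsin_rem_deriv arcsin_rem'_deriv refl | simp)+
  qed simp
  then have 1: "((\<lambda>x. (pi / 2 - x) * (?c * sin x ^ (2 * N))) has_integral arcsin_rem N (pi / 2)) {0..pi / 2}"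
    by simp
  have "((\<lambda>x. pi / 2 * ?c * (cos x * sin x ^ (2 * N))) has_integral
      pi / 2 * ?c * (sin (pi / 2) ^ (2 * N + 1) / (2 * real N + 1) - sin 0 ^ (2 * N + 1) / (2 * real N + 1))) {0..pi / 2}"
  proof (intro has_integral_mult_right fundamental_theorem_of_calculus)
    fix x :: real
    show "((\<lambda>x. sin x ^ (2 * N + 1) / (2 * real N + 1)) has_vector_derivative cos x * sin x ^ (2 * N))
        (at x within {0..pi / 2})"
      unfolding has_real_derivative_iff_has_vector_derivative [symmetric]
      using DERIV_cdivide[OF sin_power_deriv[of "2 * N" x "{0..pi / 2}"], of "2 * real N + 1"]
      by (simp add: mult.commute add_eq_0_iff)
  qed simp
  then have 2: "((\<lambda>x. pi / 2 * ?c * (cos x * sin x ^ (2 * N))) has_integral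
      pi / 2 * ?c * (1 / (2 * real N + 1))) {0..pi / 2}" by simp
  have "arcsin_rem N (pi / 2) \<le> pi / 2 * ?c * (1 / (2 * real N + 1))"
  proof (rule has_integral_le[OF 1 2])
    fix x :: real assume x: "x \<in> {0..pi / 2}"
    have "pi / 2 - x \<le> pi / 2 * cos x"
      using jordan_sin[of "pi / 2 - x"] x by (simp add: sin_diff)
    then have "(pi / 2 - x) * (?c * sin x ^ (2 * N)) \<le> (pi / 2 * cos x) * (?c * sin x ^ (2 * N))"
      using wallis_ratio_pos[of N] by (intro mult_right_mono mult_nonneg_nonneg) (auto simp: power_mult)
    then show "(pi / 2 - x) * (?c * sin x ^ (2 * N)) \<le> pi / 2 * ?c * (cos x * sin x ^ (2 * N))"
      by (simp add: mult_ac)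
  qed
  then show ?thesis by (simp add: field_simps)
qed

lemma wallis_ratio_ge: "wallis_ratio n * (2 * real n + 1) \<ge> sqrt (real n + 1)"
proof -
  have "(wallis_ratio n * (2 * real n + 1))\<^sup>2 \<ge> real n + 1"
  proof (induction n)
    case (Suc n)
    have "real (Suc n) + 1 \<le> (real n + 1) * ((2 * real n + 3) / (2 * real n + 2))\<^sup>2"
      by (simp add: divide_simps power2_eq_square) (simp add: algebra_simps)
    also have "\<dots> \<le> (wallis_ratio n * (2 * real n + 1))\<^sup>2 * ((2 * real n + 3) / (2 * real n + 2))\<^sup>2"
      using Suc by (intro mult_right_mono) auto
    also have "\<dots> = (wallis_ratio (Suc n) * (2 * real (Suc n) + 1))\<^sup>2"
    proof -
      have "wallis_ratio n * (2 * real n + 1) * ((2 * real n + 3) / (2 * real n + 2))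
          = wallis_ratio (Suc n) * (2 * real (Suc n) + 1)"
        by (simp add: wallis_ratio_Suc add_ac)
      then show ?thesis by (simp only: power_mult_distrib [symmetric])
    qed
    finally show ?case .
  qed simp
  then show ?thesis using wallis_ratio_pos[of n] by (intro real_le_lsqrt) auto
qed

lemma arcsin_rem_half_pi_tendsto_0: "(\<lambda>N. arcsin_rem N (pi / 2)) \<longlonglongrightarrow> 0"
proof (rule real_tendsto_sandwich[OF _ _ tendsto_const])
  show "(\<lambda>N. pi / sqrt (real N + 1)) \<longlonglongrightarrow> 0" by real_asymp
  show "\<forall>\<^sub>F N in sequentially. arcsin_rem N (pi / 2) \<le> pi / sqrt (real N + 1)"
  proof (intro always_eventually allI)
    fix N
    have "pi / (wallis_ratio N * (2 * real N + 1)) \<le> pi / sqrt (real N + 1)"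
      using wallis_ratio_ge[of N] wallis_ratio_pos[of N] by (intro divide_left_mono mult_pos_pos) auto
    then show "arcsin_rem N (pi / 2) \<le> pi / sqrt (real N + 1)"
      using arcsin_rem_half_pi_le[of N] by linarith
  qed
qed (simp add: arcsin_rem_nonneg)

lemma sq_over_sin_bounds:
  assumes "0 < x" "x \<le> pi / 2"
  shows "sin x > 0" "x / sin x \<le> pi / 2" "x / sin x \<ge> 0"
proof -
  show s: "sin x > 0" using assms by (intro sin_gt_zero) (auto intro: le_less_trans)
  show "x / sin x \<le> pi / 2" using jordan_sin[of x] assms s by (simp add: pos_divide_le_eq)
  show "x / sin x \<ge> 0" using s assms by simp
qed

text \<open>At \<open>x = 0\<close> the division convention \<open>0 / 0 = 0\<close> gives the correct limit.\<close>

lemma continuous_on_sq_over_sin: "continuous_on {0..pi / 2} (\<lambda>x. x\<^sup>2 / sin x)"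
  unfolding continuous_on_def
proof
  fix x assume x: "x \<in> {0..pi / 2 :: real}"
  show "((\<lambda>x. x\<^sup>2 / sin x) \<longlongrightarrow> x\<^sup>2 / sin x) (at x within {0..pi / 2})"
  proof (cases "x = 0")
    case False
    then have "sin x \<noteq> 0" using sq_over_sin_bounds(1)[of x] x by auto
    then show ?thesis by (intro tendsto_intros)
  next
    case True
    have up: "((\<lambda>x. pi / 2 * x) \<longlongrightarrow> 0) (at 0 within {0..pi / 2})"
      by (auto intro!: tendsto_eq_intros)
    have "0 \<le> x\<^sup>2 / sin x \<and> x\<^sup>2 / sin x \<le> pi / 2 * x" if "x \<in> {0..pi / 2}" "x \<noteq> 0" for x :: real
      using mult_left_mono[OF sq_over_sin_bounds(2)[of x], of x] sq_over_sin_bounds(1)[of x] that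
      by (auto simp: power2_eq_square mult.commute)
    then have "((\<lambda>x. x\<^sup>2 / sin x) \<longlongrightarrow> 0) (at 0 within {0..pi / 2})"
      by (intro real_tendsto_sandwich[OF _ _ tendsto_const up]) (auto simp: eventually_at_filter)
    then show ?thesis using True by simp
  qed
qed

text \<open>Term-by-term integration of the arcsine expansion divided by \<open>sin x\<close>, with the
  integrated remainder controlled by its value at \<open>pi/2\<close>.\<close>

lemma inverse_wallis_sums_integral:
  "(\<lambda>n. 1 / ((real n + 1) ^ 3 * (wallis_ratio (Suc n))\<^sup>2)) sums (4 * integral {0..pi / 2} (\<lambda>x. x\<^sup>2 / sin x))"
proof -
  let ?h = "\<lambda>x. x\<^sup>2 / sin x :: real"
  let ?t = "\<lambda>n. 1 / ((real n + 1) ^ 3 * (wallis_ratio (Suc n))\<^sup>2)"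
  have h: "(?h has_integral integral {0..pi / 2} ?h) {0..pi / 2}"
    by (intro integrable_integral integrable_continuous_interval continuous_on_sq_over_sin)
  have bound: "0 \<le> integral {0..pi / 2} ?h - (\<Sum>n<N. ?t n) / 4 \<and>
     integral {0..pi / 2} ?h - (\<Sum>n<N. ?t n) / 4 \<le> pi / 2 * arcsin_rem N (pi / 2)" for N
  proof -
    have "((\<lambda>x. \<Sum>n<N. sin x ^ (2 * n + 1) / (2 * (real n + 1)\<^sup>2 * wallis_ratio (Suc n))) has_integral
        (\<Sum>n<N. 1 / (2 * (real n + 1) * wallis_ratio (Suc n)) / (2 * (real n + 1)\<^sup>2 * wallis_ratio (Suc n)))) {0..pi / 2}"
      by (intro has_integral_sum has_integral_divide has_integral_sin_odd_power) auto
    also have "(\<Sum>n<N. 1 / (2 * (real n + 1) * wallis_ratio (Suc n)) / (2 * (real n + 1)\<^sup>2 * wallis_ratio (Suc n)))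
       = (\<Sum>n<N. ?t n) / 4"
    proof -
      have "1 / (2 * a * b) / (2 * a\<^sup>2 * b) = 1 / (a ^ 3 * b\<^sup>2) / 4" for a b :: real
        by (simp add: power2_eq_square power3_eq_cube mult_ac)
      then show ?thesis unfolding sum_divide_distrib by (simp only:)
    qed
    finally have int: "((\<lambda>x. ?h x - (\<Sum>n<N. sin x ^ (2 * n + 1) / (2 * (real n + 1)\<^sup>2 * wallis_ratio (Suc n)))) has_integral
       integral {0..pi / 2} ?h - (\<Sum>n<N. ?t n) / 4) {0..pi / 2}"
      by (intro has_integral_diff h)
    have eq: "?h x - (\<Sum>n<N. sin x ^ (2 * n + 1) / (2 * (real n + 1)\<^sup>2 * wallis_ratio (Suc n)))
        = arcsin_rem N x / sin x" if "x \<in> {0..pi / 2}" for x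
    proof (cases "x = 0")
      case False
      then have "sin x > 0" using sq_over_sin_bounds(1)[of x] that by auto
      then show ?thesis by (simp add: arcsin_rem_def diff_divide_distrib sum_divide_distrib)
    qed simp
    have "0 \<le> arcsin_rem N x / sin x \<and> arcsin_rem N x / sin x \<le> arcsin_rem N (pi / 2)" if "x \<in> {0..pi / 2}" for x
    proof (cases "x = 0")
      case False
      then have "sin x > 0" using sq_over_sin_bounds(1)[of x] that by auto
      then show ?thesis using arcsin_rem_le[of x N] that arcsin_rem_nonneg[of N x]
        by (simp add: pos_divide_le_eq)
    qed (simp add: arcsin_rem_nonneg)
    note b = this
    have int': "((\<lambda>x. arcsin_rem N x / sin x) has_integral
       integral {0..pi / 2} ?h - (\<Sum>n<N. ?t n) / 4) {0..pi / 2}"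
      using int by (subst (asm) has_integral_cong[OF eq]) auto
    have const: "((\<lambda>x. arcsin_rem N (pi / 2)) has_integral pi / 2 * arcsin_rem N (pi / 2)) {0..pi / 2}"
      using has_integral_const_real[of "arcsin_rem N (pi / 2)" 0 "pi / 2"] by simp
    show ?thesis
      using has_integral_nonneg[OF int'] has_integral_le[OF int' const] b by blast
  qed
  have "(\<lambda>N. integral {0..pi / 2} ?h - (\<Sum>n<N. ?t n) / 4) \<longlonglongrightarrow> 0"
  proof (rule real_tendsto_sandwich[OF _ _ tendsto_const])
    show "(\<lambda>N. pi / 2 * arcsin_rem N (pi / 2)) \<longlonglongrightarrow> 0"
      using tendsto_mult[OF tendsto_const arcsin_rem_half_pi_tendsto_0, of "pi / 2"] by simp
  qed (use bound in \<open>blast intro: always_eventually\<close>)+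
  then have "(\<lambda>N. 4 * integral {0..pi / 2} ?h - 4 * (integral {0..pi / 2} ?h - (\<Sum>n<N. ?t n) / 4))
     \<longlonglongrightarrow> 4 * integral {0..pi / 2} ?h - 4 * 0"
    by (intro tendsto_intros)
  then show ?thesis unfolding sums_def by simp
qed

text \<open>A Dirichlet-type kernel: up to the cosine, the sum of odd sines is \<open>1 / sin x\<close>.\<close>

lemma sin_odd_multiples_sum: "(\<Sum>j<N. 2 * sin ((2 * real j + 1) * x)) * sin x = 1 - cos (2 * real N * x)"
proof (induction N)
  case (Suc N)
  have "2 * sin ((2 * real N + 1) * x) * sin x = cos (2 * real N * x) - cos (2 * real (Suc N) * x)"
    using sin_times_sin[of "(2 * real N + 1) * x" x] by (simp add: algebra_simps)
  then show ?case using Suc by (simp add: algebra_simps)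
qed simp

lemma has_integral_sq_sin_odd:
  "((\<lambda>x. x\<^sup>2 * sin ((2 * real j + 1) * x)) has_integral
      pi * (- 1) ^ j / (2 * real j + 1)\<^sup>2 - 2 / (2 * real j + 1) ^ 3) {0..pi / 2}"
proof -
  define m where "m = 2 * real j + 1"
  have m: "m > 0" by (simp add: m_def)
  have "cos (m * (pi / 2)) = 0" "sin (m * (pi / 2)) = (- 1) ^ j"
  proof -
    have e: "m * (pi / 2) = real j * pi + pi / 2" by (simp add: m_def field_simps)
    show "cos (m * (pi / 2)) = 0" unfolding e by (simp add: cos_add)
    show "sin (m * (pi / 2)) = (- 1) ^ j" unfolding e by (simp add: sin_add)
  qed
  note v = this
  let ?F = "\<lambda>x. - (x\<^sup>2) * cos (m * x) / m + 2 * x * sin (m * x) / m\<^sup>2 + 2 * cos (m * x) / m ^ 3"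
  have "((\<lambda>x. x\<^sup>2 * sin (m * x)) has_integral ?F (pi / 2) - ?F 0) {0..pi / 2}"
  proof (rule fundamental_theorem_of_calculus)
    fix x :: real
    show "(?F has_vector_derivative x\<^sup>2 * sin (m * x)) (at x within {0..pi / 2})"
      unfolding has_real_derivative_iff_has_vector_derivative [symmetric] using m
      by (auto intro!: derivative_eq_intros simp: power2_eq_square power3_eq_cube field_simps)
  qed simp
  then show ?thesis unfolding v by (simp add: m_def [symmetric])
qed

text \<open>An instance of the Riemann--Lebesgue lemma. One integration by parts suffices because
  \<open>x\<^sup>2 / sin x\<close> has a bounded derivative on \<open>(0, pi/2]\<close>.\<close>

lemma sq_over_sin_fourier_tail:
  "(\<lambda>N. integral {0..pi / 2} (\<lambda>x. x\<^sup>2 / sin x * cos (2 * real N * x))) \<longlonglongrightarrow> 0"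
proof -
  let ?h = "\<lambda>x. x\<^sup>2 / sin x :: real"
  let ?h' = "\<lambda>x. (2 * x * sin x - x\<^sup>2 * cos x) / (sin x)\<^sup>2 :: real"
  let ?I = "\<lambda>N. integral {0..pi / 2} (\<lambda>x. ?h x * cos (2 * real N * x))"
  let ?B = "pi + (pi / 2)\<^sup>2"
  have bound: "\<bar>?I N\<bar> \<le> ?B / (2 * real N) * (pi / 2)" if N: "N > 0" for N
  proof -
    let ?a = "2 * real N"
    have a: "?a > 0" using N by simp
    have total: "((\<lambda>x. ?h' x * sin (?a * x) / ?a + ?h x * cos (?a * x)) has_integral
        ?h (pi / 2) * sin (?a * (pi / 2)) / ?a - ?h 0 * sin (?a * 0) / ?a) {0..pi / 2}"
    proof (rule fundamental_theorem_of_calculus_interior)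
      show "continuous_on {0..pi / 2} (\<lambda>x. ?h x * sin (?a * x) / ?a)"
        using a by (intro continuous_intros continuous_on_sq_over_sin) auto
      fix x :: real assume x: "x \<in> {0<..<pi / 2}"
      then have s: "sin x > 0" using sq_over_sin_bounds(1)[of x] by auto
      have "((\<lambda>x. ?h x * sin (?a * x) / ?a) has_real_derivative ?h' x * sin (?a * x) / ?a + ?h x * cos (?a * x)) (at x)"
        using s a by (auto intro!: derivative_eq_intros simp: power2_eq_square divide_simps) (simp add: algebra_simps)
      then show "((\<lambda>x. ?h x * sin (?a * x) / ?a) has_vector_derivative
            ?h' x * sin (?a * x) / ?a + ?h x * cos (?a * x)) (at x)"
        by (simp add: has_real_derivative_iff_has_vector_derivative)
    qed simp
    have c: "((\<lambda>x. ?h x * cos (?a * x)) has_integral ?I N) {0..pi / 2}"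
      by (intro integrable_integral integrable_continuous_interval continuous_intros continuous_on_sq_over_sin)
    have "sin (?a * (pi / 2)) = 0" by simp
    with has_integral_diff[OF total c]
    have d: "((\<lambda>x. ?h' x * sin (?a * x) / ?a) has_integral - ?I N) {0..pi / 2}" by simp
    have "norm (- ?I N) \<le> ?B / ?a * measure lborel (cbox 0 (pi / 2))"
    proof (rule has_integral_bound)
      show "((\<lambda>x. ?h' x * sin (?a * x) / ?a) has_integral - ?I N) (cbox 0 (pi / 2))" using d by simp
      show "0 \<le> ?B / ?a" using a by simp
      fix x assume x: "x \<in> cbox 0 (pi / 2)"
      show "norm (?h' x * sin (?a * x) / ?a) \<le> ?B / ?a"
      proof (cases "x = 0")
        case False
        with x have x': "0 < x" "x \<le> pi / 2" by auto
        note b = sq_over_sin_bounds[OF x']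
        have "?h' x = 2 * (x / sin x) - (x / sin x)\<^sup>2 * cos x"
          using b(1) by (simp add: power2_eq_square divide_simps)
        also have "\<bar>\<dots>\<bar> \<le> \<bar>2 * (x / sin x)\<bar> + \<bar>(x / sin x)\<^sup>2 * cos x\<bar>" by (rule abs_triangle_ineq4)
        also have "\<dots> \<le> 2 * (pi / 2) + (pi / 2)\<^sup>2 * 1"
          unfolding abs_mult using b
          by (intro add_mono mult_mono) (auto intro!: power_mono)
        finally have h': "\<bar>?h' x\<bar> \<le> ?B" by simp
        have "\<bar>?h' x\<bar> * \<bar>sin (?a * x)\<bar> \<le> ?B * 1" using h' by (intro mult_mono) auto
        then have "\<bar>?h' x\<bar> * \<bar>sin (?a * x)\<bar> / ?a \<le> ?B / ?a" using a by (intro divide_right_mono) auto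
        then show ?thesis by (simp add: abs_mult)
      qed (use a in simp)
    qed
    then show ?thesis by simp
  qed
  show ?thesis
  proof (rule Lim_null_comparison)
    show "\<forall>\<^sub>F N in sequentially. norm (?I N) \<le> ?B / (2 * real N) * (pi / 2)"
      using eventually_gt_at_top[of 0] by eventually_elim (use bound in simp)
    show "(\<lambda>N. ?B / (2 * real N) * (pi / 2)) \<longlonglongrightarrow> 0" by real_asymp
  qed
qed

lemma integral_sq_over_sin:
  "integral {0..pi / 2} (\<lambda>x. x\<^sup>2 / sin x) = 2 * pi * catalan_const - 7 / 2 * zeta 3"
proof -
  let ?h = "\<lambda>x. x\<^sup>2 / sin x :: real"
  let ?J = "\<lambda>j. pi * (- 1) ^ j / (2 * real j + 1)\<^sup>2 - 2 / (2 * real j + 1) ^ 3"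
  have h: "(?h has_integral integral {0..pi / 2} ?h) {0..pi / 2}"
    by (intro integrable_integral integrable_continuous_interval continuous_on_sq_over_sin)
  have partial: "(\<Sum>j<N. 2 * ?J j) = integral {0..pi / 2} ?h - integral {0..pi / 2} (\<lambda>x. ?h x * cos (2 * real N * x))" for N
  proof -
    have c: "((\<lambda>x. ?h x * cos (2 * real N * x)) has_integral
        integral {0..pi / 2} (\<lambda>x. ?h x * cos (2 * real N * x))) {0..pi / 2}"
      by (intro integrable_integral integrable_continuous_interval continuous_intros continuous_on_sq_over_sin)
    have "((\<lambda>x. \<Sum>j<N. 2 * (x\<^sup>2 * sin ((2 * real j + 1) * x))) has_integral (\<Sum>j<N. 2 * ?J j)) {0..pi / 2}"
      by (intro has_integral_sum has_integral_mult_right has_integral_sq_sin_odd) auto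
    moreover have "(\<Sum>j<N. 2 * (x\<^sup>2 * sin ((2 * real j + 1) * x))) = ?h x - ?h x * cos (2 * real N * x)"
      if "x \<in> {0..pi / 2}" for x
    proof (cases "x = 0")
      case False
      then have "sin x > 0" using sq_over_sin_bounds(1)[of x] that by auto
      then have "(\<Sum>j<N. 2 * sin ((2 * real j + 1) * x)) = (1 - cos (2 * real N * x)) / sin x"
        by (simp add: sin_odd_multiples_sum [symmetric])
      then have "x\<^sup>2 * (\<Sum>j<N. 2 * sin ((2 * real j + 1) * x)) = x\<^sup>2 * ((1 - cos (2 * real N * x)) / sin x)"
        by (simp only:)
      also have "\<dots> = ?h x - ?h x * cos (2 * real N * x)"
        by (simp add: diff_divide_distrib right_diff_distrib)
      finally have "x\<^sup>2 * (\<Sum>j<N. 2 * sin ((2 * real j + 1) * x)) = ?h x - ?h x * cos (2 * real N * x)" .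
      then show ?thesis by (simp add: sum_distrib_left mult_ac)
    qed simp
    ultimately have "((\<lambda>x. ?h x - ?h x * cos (2 * real N * x)) has_integral (\<Sum>j<N. 2 * ?J j)) {0..pi / 2}"
      by (subst (asm) has_integral_cong) auto
    with has_integral_diff[OF h c] show ?thesis using has_integral_unique by blast
  qed
  have "(\<lambda>N. \<Sum>j<N. 2 * ?J j) \<longlonglongrightarrow> integral {0..pi / 2} ?h - 0"
    unfolding partial by (intro tendsto_diff tendsto_const sq_over_sin_fourier_tail)
  then have "(\<lambda>j. 2 * ?J j) sums integral {0..pi / 2} ?h" by (simp add: sums_def)
  moreover have "(\<lambda>j. 2 * ?J j) sums (2 * (pi * catalan_const - 2 * (7 / 8 * zeta 3)))"
    using sums_mult[OF sums_diff[OF sums_mult[OF catalan_sums, of pi] sums_mult[OF zeta_3_odd_sums, of 2]], of 2]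
    by simp
  ultimately have "integral {0..pi / 2} ?h = 2 * (pi * catalan_const - 2 * (7 / 8 * zeta 3))"
    by (rule sums_unique2)
  then show ?thesis by simp
qed

theorem inverse_wallis_sums:
  "(\<lambda>n. 1 / ((real n + 1) ^ 3 * (wallis_ratio (Suc n))\<^sup>2)) sums (8 * pi * catalan_const - 14 * zeta 3)"
  using inverse_wallis_sums_integral unfolding integral_sq_over_sin by (simp add: algebra_simps)

section \<open>A double series of squared Wallis ratios\<close>

lemma sums_swap_nonneg:
  fixes f :: "nat \<Rightarrow> nat \<Rightarrow> real"
  assumes nonneg: "\<And>m n. f m n \<ge> 0" and rows: "\<And>m. f m sums r m" and total: "r sums S"
    and cols: "\<And>n. (\<lambda>m. f m n) sums c n"
  shows "c sums S"
proof -
  have r: "((\<lambda>n. f m n) has_sum r m) UNIV" for m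
    using rows nonneg by (intro sums_nonneg_imp_has_sum) auto
  have "r m \<ge> 0" for m using sums_le[OF _ sums_zero rows] nonneg by blast
  then have R: "(r has_sum S) UNIV" by (intro sums_nonneg_imp_has_sum total)
  have c: "((\<lambda>m. f m n) has_sum c n) UNIV" for n
    using cols nonneg by (intro sums_nonneg_imp_has_sum) auto
  have "(\<lambda>(m, n). f m n) summable_on (UNIV \<times> UNIV)"
    by (rule summable_on_SigmaI[where g = r]) (use r R nonneg in \<open>auto simp: summable_on_def\<close>)
  then have "((\<lambda>(m, n). f m n) has_sum S) (UNIV \<times> UNIV)"
    using r R by (intro has_sum_SigmaI[where g = r]) auto
  then have "((\<lambda>(n, m). f m n) has_sum S) (UNIV \<times> UNIV)"
    by (subst has_sum_swap) simp
  then have "(c has_sum S) UNIV"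
    by (rule has_sum_SigmaD) (use c in simp)
  then show ?thesis by (rule has_sum_imp_sums)
qed

text \<open>The reciprocal of the binomial coefficient \<open>n + k + 1\<close> over \<open>k\<close>.\<close>

definition inv_binom :: "nat \<Rightarrow> nat \<Rightarrow> real" where
  "inv_binom n k = fact k / pochhammer (real n + 2) k"

lemma inv_binom_pos: "inv_binom n k > 0"
  by (auto simp: inv_binom_def intro!: divide_pos_pos pochhammer_pos)

lemma inv_binom_Suc: "inv_binom n (Suc k) = inv_binom n k * ((real k + 1) / (real n + real k + 2))"
  by (simp add: inv_binom_def pochhammer_Suc mult_ac add_ac)

lemma inv_binom_Suc_left: "inv_binom (Suc n) k = inv_binom n k * ((real n + 2) / (real n + real k + 2))"
proof -
  define x where "x = real n + 2"
  have x: "x > 0" "real (Suc n) + 2 = x + 1" "real n + real k + 2 = x + k" by (simp_all add: x_def)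
  have "x * pochhammer (x + 1) k = pochhammer x k * (x + k)"
    using pochhammer_rec[of x k] pochhammer_Suc[of x k] by simp
  then have "fact k / pochhammer x k * (x / (x + k)) = fact k * x / (x * pochhammer (x + 1) k)"
    by simp
  also have "\<dots> = fact k / pochhammer (x + 1) k" using x by simp
  finally show ?thesis unfolding inv_binom_def x(2,3) x_def [symmetric] by simp
qed

lemma inv_binom_telescope:
  "inv_binom n (Suc k) / (real n + 1) = inv_binom n k / (real n + 1) - inv_binom (Suc n) k / (real (Suc n) + 1)"
proof -
  have "inv_binom n k * ((real k + 1) / (real n + real k + 2)) / (real n + 1) =
      inv_binom n k / (real n + 1) - inv_binom n k * ((real n + 2) / (real n + real k + 2)) / (real n + 2)"
  proof -
    have "real n + real k + 2 > 0" "real n + 1 > 0" "real n + 2 > 0" by simp_all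
    then show ?thesis by (simp add: divide_simps) (simp add: algebra_simps)
  qed
  then show ?thesis unfolding inv_binom_Suc inv_binom_Suc_left by (simp add: add_ac)
qed

lemma inv_binom_le_1: "inv_binom n k \<le> 1"
proof (induction k)
  case (Suc k)
  have "inv_binom n (Suc k) \<le> inv_binom n k * 1"
    unfolding inv_binom_Suc using inv_binom_pos[of n k] by (intro mult_left_mono) auto
  then show ?case using Suc by simp
qed (simp add: inv_binom_def)

lemma inv_binom_0 [simp]: "inv_binom n 0 = 1" "inv_binom 0 k = 1 / (real k + 1)"
proof -
  show "inv_binom n 0 = 1" by (simp add: inv_binom_def)
  show "inv_binom 0 k = 1 / (real k + 1)"
    by (induction k) (simp_all add: inv_binom_Suc inv_binom_def[of 0 0])
qed

lemma summable_shifted_inverse_squares: "summable (\<lambda>n. 1 / (real n + real k + 1)\<^sup>2)"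
proof -
  have "summable (\<lambda>n. 1 / (real n + 1)\<^sup>2)"
    using inverse_squares_sums by (simp add: sums_iff add_ac)
  from summable_ignore_initial_segment[OF this, of k] show ?thesis by simp
qed

text \<open>By induction on \<open>k\<close>: both sides drop by \<open>1 / (k + 1)\<^sup>2\<close> when \<open>k\<close> increases by one, on the left
  because the difference is a telescoping series.\<close>

lemma inv_binom_sums:
  "(\<lambda>n. inv_binom n k / (real n + 1)\<^sup>2) sums (\<Sum>n. 1 / (real n + real k + 1)\<^sup>2)"
proof (induction k)
  case 0
  then show ?case using summable_sums[OF summable_shifted_inverse_squares[of 0]] by simp
next
  case (Suc k)
  have "(\<lambda>n. inv_binom n k / (real n + 1) - inv_binom (Suc n) k / (real (Suc n) + 1))
          sums (inv_binom 0 k / (real 0 + 1) - 0)"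
  proof (rule telescope_sums')
    have lim: "(\<lambda>n. 1 / (real n + 1)) \<longlonglongrightarrow> 0" by real_asymp
    show "(\<lambda>n. inv_binom n k / (real n + 1)) \<longlonglongrightarrow> 0"
      by (rule real_tendsto_sandwich[OF _ _ tendsto_const lim])
         (auto simp: inv_binom_le_1 less_imp_le[OF inv_binom_pos] intro!: always_eventually divide_right_mono)
  qed
  then have tele: "(\<lambda>n. inv_binom n (Suc k) / (real n + 1)) sums (1 / (real k + 1))"
    unfolding inv_binom_telescope [symmetric] by simp
  have step: "inv_binom n k / (real n + 1)\<^sup>2 - 1 / (real k + 1) * (inv_binom n (Suc k) / (real n + 1))
      = inv_binom n (Suc k) / (real n + 1)\<^sup>2" for n
  proof -
    define a b where "a = real n + 1" and "b = real k + 1"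
    have "a > 0" "b > 0" "real n + real k + 2 = a + b" by (auto simp: a_def b_def)
    then show ?thesis unfolding inv_binom_Suc a_def [symmetric] b_def [symmetric]
      by (simp add: divide_simps power2_eq_square add_eq_0_iff) (simp add: algebra_simps)
  qed
  have "(\<lambda>n. inv_binom n (Suc k) / (real n + 1)\<^sup>2) sums
      ((\<Sum>n. 1 / (real n + real k + 1)\<^sup>2) - 1 / (real k + 1) * (1 / (real k + 1)))"
    using sums_diff[OF Suc sums_mult[OF tele, of "1 / (real k + 1)"]] unfolding step .
  also have "(\<Sum>n. 1 / (real n + real k + 1)\<^sup>2) - 1 / (real k + 1) * (1 / (real k + 1))
      = (\<Sum>n. 1 / (real n + real (Suc k) + 1)\<^sup>2)"
    using suminf_split_head[OF summable_shifted_inverse_squares[of k]]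
    by (simp add: power2_eq_square add_ac)
  finally show ?case .
qed

text \<open>Gauss's theorem at \<open>a = b = 1/2\<close> and \<open>c = n + 2\<close>.\<close>

lemma gauss_half_sums:
  "(\<lambda>k. (wallis_ratio k)\<^sup>2 * inv_binom n k) sums (1 / (pi * (real n + 1) * (wallis_ratio (Suc n))\<^sup>2))"
proof -
  have G: "Gamma (1 / 2 + real m) = pochhammer (1 / 2) m * sqrt pi" for m
    using pochhammer_Gamma[of "1 / 2 :: real" m] pos_notin_nonpos_Ints[of "1 / 2"]
    by (simp add: Gamma_one_half_real)
  have "Gamma (real n + 2) = fact (Suc n)" "Gamma (real n + 1) = fact n"
    using Gamma_fact[of "Suc n", where ?'a = real] Gamma_fact[of n, where ?'a = real] by (simp_all add: add_ac)
  moreover have "Gamma (real n + 3 / 2) = pochhammer (1 / 2) (Suc n) * sqrt pi"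
    using G[of "Suc n"] by (simp add: add_ac)
  moreover have "gauss_term (1 / 2) (1 / 2) (real n + 2) sums
      (Gamma (real n + 2) * Gamma (real n + 1) / (Gamma (real n + 3 / 2) * Gamma (real n + 3 / 2)))"
    using gauss_summation[of "1 / 2" "1 / 2" "real n + 2"] by (simp add: add_ac)
  ultimately have "gauss_term (1 / 2) (1 / 2) (real n + 2) sums
      (fact (Suc n) * fact n / (pochhammer (1 / 2) (Suc n) * sqrt pi * (pochhammer (1 / 2) (Suc n) * sqrt pi)))"
    by (simp only:)
  also have "fact (Suc n) * fact n / (pochhammer (1 / 2) (Suc n) * sqrt pi * (pochhammer (1 / 2) (Suc n) * sqrt pi))
     = 1 / (pi * (real n + 1) * (wallis_ratio (Suc n))\<^sup>2)"
  proof -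
    have "pochhammer (1 / 2) (Suc n) > (0::real)" by (intro pochhammer_pos) auto
    moreover have "sqrt pi * sqrt pi = pi" by simp
    moreover have "(fact (Suc n) :: real) = (real n + 1) * fact n" by simp
    ultimately show ?thesis unfolding wallis_ratio_def
      by (simp del: fact_Suc add: power_divide power2_eq_square mult_ac)
  qed
  also have "gauss_term (1 / 2) (1 / 2) (real n + 2) = (\<lambda>k. (wallis_ratio k)\<^sup>2 * inv_binom n k)"
    by (simp add: fun_eq_iff gauss_term_def wallis_ratio_def inv_binom_def power2_eq_square)
  finally show ?thesis .
qed

text \<open>The double series with terms \<open>c_k\<^sup>2 inv_binom n k / (n + 1)\<^sup>2\<close> is summed in both orders. Summing over \<open>k\<close> first
  gives the reciprocal Wallis series; summing over \<open>n\<close> first gives \<open>\<Sum> c_k\<^sup>2 \<Sum>_{m \<ge> k} 1 / (m + 1)\<^sup>2\<close>, and a second exchange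
  collects the terms with equal \<open>m\<close>.\<close>

theorem wallis_partial_sums_sums:
  "(\<lambda>m. (\<Sum>k\<le>m. (wallis_ratio k)\<^sup>2) / (real m + 1)\<^sup>2) sums (8 * catalan_const - 14 * zeta 3 / pi)"
proof -
  let ?t = "\<lambda>k. (wallis_ratio k)\<^sup>2"
  let ?\<psi> = "\<lambda>k. \<Sum>n. 1 / (real n + real k + 1)\<^sup>2"
  have "(\<lambda>k. ?t k * ?\<psi> k) sums (1 / pi * (8 * pi * catalan_const - 14 * zeta 3))"
  proof (rule sums_swap_nonneg)
    show "0 \<le> ?t k * (inv_binom n k / (real n + 1)\<^sup>2)" for n k
      using inv_binom_pos[of n k] by (intro mult_nonneg_nonneg) auto
    show "(\<lambda>k. ?t k * (inv_binom n k / (real n + 1)\<^sup>2)) sums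
            (1 / pi * (1 / ((real n + 1) ^ 3 * (wallis_ratio (Suc n))\<^sup>2)))" for n
      using sums_divide[OF gauss_half_sums[of n], of "(real n + 1)\<^sup>2"]
      by (simp add: power2_eq_square power3_eq_cube mult_ac)
    show "(\<lambda>n. 1 / pi * (1 / ((real n + 1) ^ 3 * (wallis_ratio (Suc n))\<^sup>2))) sums
            (1 / pi * (8 * pi * catalan_const - 14 * zeta 3))"
      by (intro sums_mult inverse_wallis_sums)
    show "(\<lambda>n. ?t k * (inv_binom n k / (real n + 1)\<^sup>2)) sums (?t k * ?\<psi> k)" for k
      by (intro sums_mult inv_binom_sums)
  qed
  also have "1 / pi * (8 * pi * catalan_const - 14 * zeta 3) = 8 * catalan_const - 14 * zeta 3 / pi"
    by (simp add: field_simps)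
  finally have total: "(\<lambda>k. ?t k * ?\<psi> k) sums (8 * catalan_const - 14 * zeta 3 / pi)" .
  show ?thesis
  proof (rule sums_swap_nonneg[OF _ _ total])
    let ?f = "\<lambda>k m. if k \<le> m then ?t k / (real m + 1)\<^sup>2 else 0"
    show "0 \<le> ?f k m" for k m by simp
    show "?f k sums (?t k * ?\<psi> k)" for k
    proof -
      have "(\<lambda>n. ?t k * (1 / (real n + real k + 1)\<^sup>2)) sums (?t k * ?\<psi> k)"
        by (intro sums_mult summable_sums summable_shifted_inverse_squares)
      moreover have "(\<lambda>n. ?t k * (1 / (real n + real k + 1)\<^sup>2)) = (\<lambda>n. ?f k (n + k))"
        by simp
      ultimately have "(\<lambda>n. ?f k (n + k)) sums (?t k * ?\<psi> k)" by simp
      then show ?thesis by (subst (asm) sums_iff_shift) simp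
    qed
    show "(\<lambda>k. ?f k m) sums ((\<Sum>k\<le>m. ?t k) / (real m + 1)\<^sup>2)" for m
    proof -
      have "(\<lambda>k. ?f k m) sums (\<Sum>k\<le>m. ?f k m)" by (rule sums_finite) auto
      then show ?thesis by (simp add: sum_divide_distrib)
    qed
  qed
qed

section \<open>Abel summation and the limit of the correction term\<close>

abbreviation base_term :: "real \<Rightarrow> nat \<Rightarrow> real" where
  "base_term w \<equiv> gauss_term (1 / 2 + w) (1 / 2 + w) (1 + w)"

text \<open>What Abel summation of the damped Gauss series leaves, after removing the factor \<open>w\<^sup>2\<close>.\<close>

definition corr_term :: "real \<Rightarrow> nat \<Rightarrow> real" where
  "corr_term w k = (\<Sum>i\<le>k. base_term w i) * damping w (Suc k) / ((real k + 1) * (real k + 1 + w))"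

lemma damping_diff:
  assumes "- 1 / 4 \<le> w"
  shows "damping w k - damping w (Suc k) = w\<^sup>2 * (damping w (Suc k) / ((real k + 1) * (real k + 1 + w)))"
proof -
  have q: "quad w (real k + 1) > 0" by (intro quad_pos) auto
  define m where "m = (real k + 1) * (real k + 1 + w)"
  have m: "m > 0" unfolding m_def using assms by (intro mult_pos_pos) auto
  have d: "damping w (Suc k) = damping w k * (m / quad w (real k + 1))"
    by (simp add: damping_def m_def)
  have qm: "quad w (real k + 1) = m + w\<^sup>2" by (simp add: quad_def m_def power2_eq_square algebra_simps)
  show ?thesis unfolding d m_def [symmetric] using q m unfolding qm
    by (simp add: divide_simps) (simp add: algebra_simps)
qed

lemma damped_partial_sum:
  assumes "- 1 / 4 \<le> w"
  shows "(\<Sum>k<K. base_term w k * damping w k)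
           = (\<Sum>k<K. base_term w k) * damping w K + w\<^sup>2 * (\<Sum>k<K. corr_term w k)"
proof (induction K)
  case (Suc K)
  have "w\<^sup>2 * corr_term w K = (\<Sum>i\<le>K. base_term w i) * (damping w K - damping w (Suc K))"
    unfolding damping_diff[OF assms] corr_term_def by simp
  with Suc show ?case
    by (simp add: lessThan_Suc_atMost [symmetric] algebra_simps)
qed simp

text \<open>The quotient is \<open>\<Prod> (1 + (- y) / i^3)\<close> with nonnegative \<open>- y / i^3\<close>, hence lies between the
  linear and the exponential bound for such products.\<close>

lemma cubic_den_ratio_bounds:
  assumes "y < 0"
  shows "1 - y * (\<Sum>i<N. 1 / (real i + 1) ^ 3) \<le> cubic_den y N / fact N ^ 3"
    "cubic_den y N / fact N ^ 3 \<le> exp (- y * (\<Sum>i<N. 1 / (real i + 1) ^ 3))"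
proof -
  have "fact N = (\<Prod>i<N. real i + 1)"
    by (simp add: fact_prod_Suc lessThan_atLeast0 add_ac)
  then have "cubic_den y N / fact N ^ 3 = (\<Prod>i<N. ((real i + 1) ^ 3 - y) / (real i + 1) ^ 3)"
    by (simp add: cubic_den_def prod_dividef prod_power_distrib)
  also have "\<dots> = (\<Prod>i<N. 1 + (- y) * (1 / (real i + 1) ^ 3))"
  proof (rule prod.cong)
    fix i
    have "(real i + 1) ^ 3 > 0" by simp
    then show "((real i + 1) ^ 3 - y) / (real i + 1) ^ 3 = 1 + (- y) * (1 / (real i + 1) ^ 3)"
      by (simp add: diff_divide_distrib)
  qed simp
  finally have eq: "cubic_den y N / fact N ^ 3 = \<dots>" .
  have nonneg: "0 \<le> (- y) * (1 / (real i + 1) ^ 3)" for i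
    using assms by (intro mult_nonneg_nonneg) auto
  have "1 + (\<Sum>i\<in>A. f i) \<le> (\<Prod>i\<in>A. 1 + f i)" if "finite A" "\<And>i. f i \<ge> 0" for A and f :: "nat \<Rightarrow> real"
    using that(1)
  proof induction
    case (insert a A)
    have "(\<Prod>i\<in>A. 1 + f i) \<ge> 1" using that(2) by (intro prod_ge_1) auto
    then have "f a * 1 \<le> f a * (\<Prod>i\<in>A. 1 + f i)" using that(2) by (intro mult_left_mono)
    then show ?case using insert by (simp add: algebra_simps)
  qed simp
  from this[of "{..<N}", OF _ nonneg] show "1 - y * (\<Sum>i<N. 1 / (real i + 1) ^ 3) \<le> cubic_den y N / fact N ^ 3"
    unfolding eq sum_distrib_left [symmetric] by simp
  show "cubic_den y N / fact N ^ 3 \<le> exp (- y * (\<Sum>i<N. 1 / (real i + 1) ^ 3))"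
    unfolding eq sum_distrib_left by (rule prod_le_exp_sum) (rule nonneg)
qed

lemma base_suminf:
  assumes w: "- 1 / 4 \<le> w" "w < 0"
  shows "- w * (\<Sum>k. base_term w k) = Gamma (1 + w) * Gamma (1 - w) / pi"
proof -
  have "(\<Sum>k. base_term w k) = Gamma (1 + w) * Gamma (- w) / (Gamma (1 / 2) * Gamma (1 / 2))"
    using gauss_summation[of "1 / 2 + w" "1 / 2 + w" "1 + w"] w by (simp add: sums_iff)
  moreover have "- w \<notin> \<int>\<^sub>\<le>\<^sub>0" using w by (intro pos_notin_nonpos_Ints) auto
  from Gamma_plus1[OF this] have "Gamma (1 - w) = - w * Gamma (- w)" by simp
  ultimately show ?thesis by (simp add: Gamma_one_half_real)
qed

text \<open>The factors \<open>(1 + w)_N\<close> cancel, and the reflection-type product \<open>Gamma (1 + w) Gamma (1 - w)\<close> is the limit of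
  \<open>N!\<^sup>2 / ((1 + w)_N (1 - w)_N)\<close>. This is how the product of the
  \<open>(1 - w^3 / i^3)^(-1)\<close> emerges exactly.\<close>

lemma damping_limit:
  assumes w: "- 1 / 4 \<le> w" "w < 0"
  shows "(\<lambda>N. fact N ^ 3 / cubic_den (w ^ 3) N / damping w N) \<longlonglongrightarrow> Gamma (1 + w) * Gamma (1 - w)"
proof -
  have "(\<lambda>N. (pochhammer 1 N / pochhammer (1 + w) N * real N powr (1 + w - 1)) *
      (pochhammer 1 N / pochhammer (1 - w) N * real N powr (1 - w - 1)))
      \<longlonglongrightarrow> Gamma (1 + w) / Gamma 1 * (Gamma (1 - w) / Gamma 1)"
    using w by (intro tendsto_mult pochhammer_ratio_asymptotics) auto
  moreover have "\<forall>\<^sub>F N in sequentially. (pochhammer 1 N / pochhammer (1 + w) N * real N powr (1 + w - 1)) *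
      (pochhammer 1 N / pochhammer (1 - w) N * real N powr (1 - w - 1))
      = fact N ^ 3 / cubic_den (w ^ 3) N / damping w N"
    using eventually_gt_at_top[of 0]
  proof eventually_elim
    case (elim N)
    have damp: "damping w N = pochhammer (1 + w) N * fact N / (\<Prod>i<N. quad w (real i + 1))"
      unfolding damping_def pochhammer_times_fact by (rule prod_dividef)
    have "(\<Prod>i<N. quad w (real i + 1)) > 0" by (intro prod_pos) (auto intro!: quad_pos)
    moreover have "pochhammer (1 + w) N > 0" "pochhammer (1 - w) N > 0"
      using w by (auto intro!: pochhammer_pos)
    moreover have "real N powr w * real N powr (- w) = 1"
      using elim by (simp add: powr_minus)
    ultimately show ?case using elim
      unfolding damp cubic_den_factor pochhammer_fact [symmetric]
      by (simp del: prod_zero_iff add: field_simps power3_eq_cube powr_minus)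
  qed
  ultimately show ?thesis by (simp add: tendsto_cong)
qed

text \<open>The quantity \<open>A\<close> is the infinite product \<open>\<Prod> (1 - w^3 / i^3)^(-1)\<close>; only the two bounds, which
  agree to first order in \<open>w^3\<close>, matter later.\<close>

theorem fast_sums_corrected:
  assumes w: "- 1 / 4 \<le> w" "w < 0"
  obtains A where "fast_term (w ^ 3) sums (16 * (A / pi - w ^ 3 * (\<Sum>k. corr_term w k)))"
    "exp (w ^ 3 * zeta 3) \<le> A" "A \<le> 1 / (1 - w ^ 3 * zeta 3)"
proof -
  have y: "w ^ 3 < 0" using w by (simp add: power_less_zero_eq)
  have Z: "(\<lambda>N. \<Sum>i<N. 1 / (real i + 1) ^ 3) \<longlonglongrightarrow> zeta 3"
    using zeta_3_sums by (simp add: sums_def)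
  have Zpos: "zeta 3 > (0::real)"
  proof -
    have "0 < (\<Sum>k. 1 / (real k + 1) ^ 3)"
      using zeta_3_sums by (intro suminf_pos) (auto simp: sums_iff)
    then show ?thesis using zeta_3_sums by (simp add: sums_iff)
  qed
  have "decseq (damping w)"
  proof (rule decseq_SucI)
    fix k
    have "damping w k - damping w (Suc k) \<ge> 0"
      unfolding damping_diff[OF w(1)] using w less_imp_le[OF damping_pos[of w "Suc k"]]
      by (intro mult_nonneg_nonneg divide_nonneg_pos mult_pos_pos) auto
    then show "damping w (Suc k) \<le> damping w k" by simp
  qed
  then obtain r where r: "damping w \<longlonglongrightarrow> r"
    using decseq_convergent[of "damping w" 0] damping_pos[of w] w by (metis less_imp_le)
  define G where "G = Gamma (1 + w) * Gamma (1 - w)"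
  define A where "A = G * r"
  have "(\<lambda>N. fact N ^ 3 / cubic_den (w ^ 3) N / damping w N * damping w N) \<longlonglongrightarrow> A"
    unfolding A_def G_def by (intro tendsto_mult damping_limit r w)
  moreover have "damping w N \<noteq> 0" for N using damping_pos[of w N] w by simp
  ultimately have A: "(\<lambda>N. fact N ^ 3 / cubic_den (w ^ 3) N) \<longlonglongrightarrow> A" by simp
  have cpos: "0 < cubic_den (w ^ 3) N" for N
    unfolding cubic_den_def
  proof (intro prod_pos ballI)
    fix i
    have "(real i + 1) ^ 3 > 0" by simp
    then show "(real i + 1) ^ 3 - w ^ 3 > 0" using y by linarith
  qed
  \<comment> \<open>Both bounds for the finite products pass to the limit.\<close>
  have upper: "A \<le> 1 / (1 - w ^ 3 * zeta 3)"
  proof (rule LIMSEQ_le[OF A])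
    show "(\<lambda>N. 1 / (1 - w ^ 3 * (\<Sum>i<N. 1 / (real i + 1) ^ 3))) \<longlonglongrightarrow> 1 / (1 - w ^ 3 * zeta 3)"
      using y Zpos mult_neg_pos[OF y Zpos] by (intro tendsto_intros Z) auto
    show "\<exists>N. \<forall>n\<ge>N. fact n ^ 3 / cubic_den (w ^ 3) n \<le> 1 / (1 - w ^ 3 * (\<Sum>i<n. 1 / (real i + 1) ^ 3))"
    proof (intro exI allI impI)
      fix n
      have "(\<Sum>i<n. 1 / (real i + 1) ^ 3) \<ge> 0" by (intro sum_nonneg) auto
      then have "1 - w ^ 3 * (\<Sum>i<n. 1 / (real i + 1) ^ 3) > 0"
        using y mult_nonpos_nonneg[of "w ^ 3"] by (smt (verit))
      then have "1 / (cubic_den (w ^ 3) n / fact n ^ 3) \<le> 1 / (1 - w ^ 3 * (\<Sum>i<n. 1 / (real i + 1) ^ 3))"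
        using cubic_den_ratio_bounds(1)[OF y, of n] cpos[of n] by (intro divide_left_mono) auto
      then show "fact n ^ 3 / cubic_den (w ^ 3) n \<le> 1 / (1 - w ^ 3 * (\<Sum>i<n. 1 / (real i + 1) ^ 3))" by simp
    qed
  qed
  have lower: "exp (w ^ 3 * zeta 3) \<le> A"
  proof (rule LIMSEQ_le[OF _ A])
    show "(\<lambda>N. exp (w ^ 3 * (\<Sum>i<N. 1 / (real i + 1) ^ 3))) \<longlonglongrightarrow> exp (w ^ 3 * zeta 3)"
      by (intro tendsto_intros Z)
    show "\<exists>N. \<forall>n\<ge>N. exp (w ^ 3 * (\<Sum>i<n. 1 / (real i + 1) ^ 3)) \<le> fact n ^ 3 / cubic_den (w ^ 3) n"
    proof (intro exI allI impI)
      fix n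
      have "1 / exp (- (w ^ 3) * (\<Sum>i<n. 1 / (real i + 1) ^ 3)) \<le> 1 / (cubic_den (w ^ 3) n / fact n ^ 3)"
        using cubic_den_ratio_bounds(2)[OF y, of n] cpos[of n] by (intro divide_left_mono) auto
      then show "exp (w ^ 3 * (\<Sum>i<n. 1 / (real i + 1) ^ 3)) \<le> fact n ^ 3 / cubic_den (w ^ 3) n"
        by (simp add: exp_minus inverse_eq_divide)
    qed
  qed
  have sm: "summable (base_term w)" using w by (intro summable_gauss_term) auto
  have smd: "summable (\<lambda>k. base_term w k * damping w k)"
    using summable_wz_weight[OF w, of 0] unfolding wz_weight_eq_damped_gauss_term[OF w, abs_def] .
  have "(\<lambda>K. (\<Sum>k<K. base_term w k * damping w k) - (\<Sum>k<K. base_term w k) * damping w K)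
      \<longlonglongrightarrow> (\<Sum>k. base_term w k * damping w k) - (\<Sum>k. base_term w k) * r"
    by (intro tendsto_intros summable_LIMSEQ sm smd r)
  then have "(\<lambda>K. w\<^sup>2 * (\<Sum>k<K. corr_term w k)) \<longlonglongrightarrow> (\<Sum>k. base_term w k * damping w k) - (\<Sum>k. base_term w k) * r"
    using w by (simp add: damped_partial_sum)
  from tendsto_mult[OF tendsto_const this, of "1 / w\<^sup>2"]
  have "corr_term w sums (1 / w\<^sup>2 * ((\<Sum>k. base_term w k * damping w k) - (\<Sum>k. base_term w k) * r))"
    using w unfolding sums_def by simp
  then have damped: "(\<Sum>k. base_term w k * damping w k) = (\<Sum>k. base_term w k) * r + w\<^sup>2 * (\<Sum>k. corr_term w k)"
    using w by (simp add: sums_iff)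
  have "- w * (\<Sum>k. base_term w k * damping w k) = (- w * (\<Sum>k. base_term w k)) * r - w ^ 3 * (\<Sum>k. corr_term w k)"
    unfolding damped by (simp add: power2_eq_square power3_eq_cube algebra_simps)
  also have "\<dots> = A / pi - w ^ 3 * (\<Sum>k. corr_term w k)"
    unfolding base_suminf[OF w] A_def G_def by simp
  finally have "fast_term (w ^ 3) sums (16 * (A / pi - w ^ 3 * (\<Sum>k. corr_term w k)))"
    using fast_sums_damped[OF w] by simp
  from that[OF this lower upper] show ?thesis .
qed

lemma wallis_sq_le: "(wallis_ratio k)\<^sup>2 \<le> 1 / (2 * real k + 1)"
proof (induction k)
  case (Suc k)
  have "(wallis_ratio (Suc k))\<^sup>2 = (wallis_ratio k)\<^sup>2 * ((2 * real k + 1) / (2 * real k + 2))\<^sup>2"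
    unfolding wallis_ratio_Suc power_mult_distrib ..
  also have "\<dots> \<le> 1 / (2 * real k + 1) * ((2 * real k + 1) / (2 * real k + 2))\<^sup>2"
    using Suc by (intro mult_right_mono) auto
  also have "\<dots> \<le> 1 / (2 * real (Suc k) + 1)"
    by (simp add: divide_simps power2_eq_square) (simp add: algebra_simps)
  finally show ?case .
qed simp

lemma wallis_sq_partial_sum_le: "(\<Sum>i\<le>k. (wallis_ratio i)\<^sup>2) \<le> 2 * sqrt (real k + 1)"
proof (induction k)
  case (Suc k)
  define a b where "a = sqrt (real k + 1)" and "b = sqrt (real k + 2)"
  have ab: "a \<ge> 1" "a \<le> b" "b * b = real k + 2" "a * a = real k + 1"
    by (auto simp: a_def b_def)
  then have b: "b \<le> b * b" using mult_left_mono[of 1 b b] by simp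
  have "(wallis_ratio (Suc k))\<^sup>2 \<le> 1 / (2 * real (Suc k) + 1)" by (rule wallis_sq_le)
  also have "\<dots> \<le> 1 / (real k + 2)" by (intro divide_left_mono) auto
  also have "\<dots> \<le> 1 / b" using ab b by (intro divide_left_mono mult_pos_pos) auto
  also have "\<dots> \<le> 2 * (b - a)"
  proof -
    have "(b - a) * (b + a) = 1" using ab by (simp add: algebra_simps)
    moreover have "(b - a) * (b + a) \<le> (b - a) * (2 * b)" using ab by (intro mult_left_mono) auto
    ultimately show ?thesis using ab by (subst pos_divide_le_eq) (auto simp: algebra_simps)
  qed
  finally show ?case using Suc by (simp add: a_def b_def add_ac)
qed simp

lemma base_term_0: "base_term 0 k = (wallis_ratio k)\<^sup>2"
  by (simp add: gauss_term_def wallis_ratio_def power2_eq_square pochhammer_fact)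

text \<open>Each factor of the term increases with \<open>w\<close>. The bound by the value at \<open>w = 0\<close> provides
  a majorant independent of \<open>w\<close>.\<close>

lemma base_term_le:
  assumes w: "- 1 / 4 \<le> w" "w < 0"
  shows "base_term w k \<le> base_term 0 k"
proof (induction k)
  case (Suc k)
  let ?k = "real k"
  have "(1 / 2 + w + ?k) * (1 / 2 + w + ?k) / ((1 + w + ?k) * (?k + 1))
      \<le> (1 / 2 + 0 + ?k) * (1 / 2 + 0 + ?k) / ((1 + 0 + ?k) * (?k + 1))"
  proof -
    have "(1 / 2 + w + ?k) / (1 + w + ?k) \<le> (1 / 2 + 0 + ?k) / (1 + 0 + ?k)"
      using w by (simp add: divide_simps) (simp add: algebra_simps)
    moreover have "(1 / 2 + w + ?k) / (?k + 1) \<le> (1 / 2 + 0 + ?k) / (?k + 1)"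
      using w by (intro divide_right_mono) auto
    ultimately have "((1 / 2 + w + ?k) / (1 + w + ?k)) * ((1 / 2 + w + ?k) / (?k + 1))
       \<le> ((1 / 2 + 0 + ?k) / (1 + 0 + ?k)) * ((1 / 2 + 0 + ?k) / (?k + 1))"
      using w by (intro mult_mono) auto
    then show ?thesis by (simp only: times_divide_times_eq)
  qed
  with Suc show ?case
    unfolding gauss_term_Suc using w
    by (intro mult_mono) (auto intro!: less_imp_le[OF gauss_term_pos] divide_nonneg_pos mult_nonneg_nonneg)
qed simp

lemma damping_0: "damping 0 k = 1"
  unfolding damping_def by (rule prod.neutral) (auto simp: quad_def power2_eq_square)

lemma corr_term_0: "corr_term 0 k = (\<Sum>i\<le>k. (wallis_ratio i)\<^sup>2) / (real k + 1)\<^sup>2"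
  unfolding corr_term_def base_term_0 damping_0 by (simp add: power2_eq_square)

lemma corr_term_tendsto: "((\<lambda>w. corr_term w k) \<longlongrightarrow> corr_term 0 k) (at_left 0)"
proof -
  have w: "((\<lambda>w. w) \<longlongrightarrow> 0) (at_left (0::real))" by simp
  have q: "((\<lambda>w. quad w m) \<longlongrightarrow> quad 0 m) (at_left 0)" for m
    unfolding quad_def by (intro tendsto_intros w)
  have "((\<lambda>w. damping w j) \<longlongrightarrow> damping 0 j) (at_left 0)" for j
    unfolding damping_def by (intro tendsto_intros w q) (auto simp: quad_def)
  moreover have "((\<lambda>w. base_term w i) \<longlongrightarrow> base_term 0 i) (at_left 0)" for i
    unfolding gauss_term_def pochhammer_prod by (intro tendsto_intros w) auto
  ultimately show ?thesis unfolding corr_term_def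
    by (intro tendsto_intros w) auto
qed

lemma eventually_small_negative: "\<forall>\<^sub>F w in at_left 0. - 1 / 4 \<le> w \<and> w < (0::real)"
  by (auto simp: eventually_at_left_field intro!: exI[of _ "- 1 / 4"])

text \<open>Tannery's theorem with a majorant of order \<open>k^(-3/2)\<close>: the partial sums of the squared Wallis
  ratios are \<open>O(sqrt k)\<close>, and the denominators are of order \<open>k\<^sup>2\<close>.\<close>

lemma corr_suminf_tendsto:
  "((\<lambda>w. \<Sum>k. corr_term w k) \<longlongrightarrow> 8 * catalan_const - 14 * zeta 3 / pi) (at_left 0)"
proof -
  let ?M = "\<lambda>k. 8 / 3 * (1 / real (Suc k) powr (3 / 2))"
  have bound: "norm (corr_term w k) \<le> ?M k" if w: "- 1 / 4 \<le> w" "w < 0" for w k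
  proof -
    let ?x = "real k + 1"
    have bpos: "base_term w i \<ge> 0" for i using w by (intro less_imp_le gauss_term_pos) auto
    have "(\<Sum>i\<le>k. base_term w i) \<le> (\<Sum>i\<le>k. (wallis_ratio i)\<^sup>2)"
      unfolding base_term_0 [symmetric] by (intro sum_mono base_term_le w)
    also have "\<dots> \<le> 2 * sqrt ?x" by (rule wallis_sq_partial_sum_le)
    finally have h: "(\<Sum>i\<le>k. base_term w i) \<le> 2 * sqrt ?x" .
    have num: "(\<Sum>i\<le>k. base_term w i) * damping w (Suc k) \<le> 2 * sqrt ?x * 1"
      using h damping_le_1[of w "Suc k"] damping_pos[of w "Suc k"] w
      by (intro mult_mono) (auto intro!: sum_nonneg bpos)
    have den: "?x * (?x + w) \<ge> ?x * (3 / 4 * ?x)" using w by (intro mult_left_mono) auto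
    have nonneg: "corr_term w k \<ge> 0" unfolding corr_term_def
      using w damping_pos[of w "Suc k"] by (intro divide_nonneg_pos mult_nonneg_nonneg sum_nonneg bpos mult_pos_pos) auto
    have "corr_term w k \<le> (2 * sqrt ?x * 1) / (?x * (3 / 4 * ?x))"
      unfolding corr_term_def using num den by (intro frac_le) auto
    also have "\<dots> = ?M k"
    proof -
      have "?x powr (3 / 2) = ?x powr (1 + 1 / 2)" by simp
      also have "\<dots> = ?x * sqrt ?x" by (subst powr_add) (simp add: powr_half_sqrt)
      finally have e: "real (Suc k) powr (3 / 2) = ?x * sqrt ?x" by (simp add: add_ac)
      have s: "?x = sqrt ?x * sqrt ?x" by simp
      have "sqrt ?x > 0" by simp
      then show ?thesis unfolding e
        by (simp add: divide_simps)
    qed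
    finally show ?thesis using nonneg by simp
  qed
  have sm: "summable ?M"
  proof (intro summable_mult)
    have "summable (\<lambda>k. real k powr (- 3 / 2))" by (simp add: summable_real_powr_iff)
    then have "summable (\<lambda>k. real (Suc k) powr (- 3 / 2))" by (subst summable_Suc_iff)
    then show "summable (\<lambda>k. 1 / real (Suc k) powr (3 / 2))" by (simp add: powr_minus_divide)
  qed
  have "((\<lambda>w. \<Sum>k. corr_term w k) \<longlongrightarrow> (\<Sum>k. corr_term 0 k)) (at_left 0)"
  proof (rule tannerys_theorem[THEN conjunct2, THEN conjunct2])
    show "\<forall>\<^sub>F (k, w) in at_top \<times>\<^sub>F at_left 0. norm (corr_term w k) \<le> ?M k"
      unfolding eventually_prod_filter
      by (rule exI[of _ "\<lambda>_. True"], rule exI[of _ "\<lambda>w. - 1 / 4 \<le> w \<and> w < 0"]) (use eventually_small_negative bound in auto)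
  qed (use corr_term_tendsto sm in auto)
  moreover have "(\<Sum>k. corr_term 0 k) = 8 * catalan_const - 14 * zeta 3 / pi"
    unfolding corr_term_0 using wallis_partial_sums_sums by (simp add: sums_iff)
  ultimately show ?thesis by simp
qed

section \<open>Differentiating the fast series\<close>

lemma gen_harm_0 [simp]: "gen_harm l 0 = 0"
  by (simp add: gen_harm_def)

lemma gen_harm_Suc: "gen_harm l (Suc n) = gen_harm l n + 1 / (real n + 1) ^ l"
  by (simp add: gen_harm_def add_ac)

text \<open>The sum is eight times the sum of reciprocal odd cubes. This is where \<open>H_2n\<close> enters beside \<open>H_n\<close>.\<close>

lemma sum_half_odd_cubes: "(\<Sum>i<n. 1 / (real i + 1 / 2) ^ 3) = 8 * gen_harm 3 (2 * n) - gen_harm 3 n"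
proof (induction n)
  case (Suc n)
  have h: "gen_harm 3 (2 * Suc n) = gen_harm 3 (2 * n) + 1 / (2 * real n + 1) ^ 3 + 1 / (2 * real n + 2) ^ 3"
    using gen_harm_Suc[of 3 "2 * n"] gen_harm_Suc[of 3 "Suc (2 * n)"] by (simp add: add_ac)
  have "real n + 1 / 2 = (2 * real n + 1) / 2" "2 * real n + 2 = 2 * (real n + 1)" by simp_all
  then have "1 / (real n + 1 / 2) ^ 3 = 8 * (1 / (2 * real n + 1) ^ 3)" "8 * (1 / (2 * real n + 2) ^ 3) = 1 / (real n + 1) ^ 3"
    by (simp_all only: power_divide power_mult_distrib) simp_all
  then show ?case unfolding h gen_harm_Suc sum.lessThan_Suc Suc by (simp add: algebra_simps)
qed simp

lemma cubic_num_0_pos: "cubic_num 0 n > 0" and cubic_den_0_pos: "cubic_den 0 n > 0"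
  by (simp_all add: cubic_num_def cubic_den_def prod_pos)

lemma cubic_num_deriv:
  "((\<lambda>y. cubic_num y n) has_real_derivative cubic_num 0 n * (\<Sum>i<n. 1 / (real i + 1 / 2) ^ 3)) (at 0)"
proof (induction n)
  case (Suc n)
  have "((\<lambda>y. (real n + 1 / 2) ^ 3 + y) has_real_derivative 1) (at 0)"
    by (auto intro!: derivative_eq_intros)
  from DERIV_mult[OF Suc this]
  have d: "((\<lambda>y. cubic_num y (Suc n)) has_real_derivative
      cubic_num 0 n * (\<Sum>i<n. 1 / (real i + 1 / 2) ^ 3) * ((real n + 1 / 2) ^ 3 + 0) + 1 * cubic_num 0 n) (at 0)"
    by (simp add: cubic_num_def)
  define a where "a = (real n + 1 / 2) ^ 3"
  have "a > 0" by (simp add: a_def)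
  then have "cubic_num 0 n * s * (a + 0) + 1 * cubic_num 0 n = cubic_num 0 n * (a + 0) * (s + 1 / a)" for s
    by (simp add: field_simps)
  from d[folded a_def, unfolded this] show ?case
    by (simp add: cubic_num_def a_def)
qed (simp add: cubic_num_def)

lemma cubic_den_deriv:
  "((\<lambda>y. cubic_den y n) has_real_derivative - (cubic_den 0 n * gen_harm 3 n)) (at 0)"
proof (induction n)
  case (Suc n)
  have "((\<lambda>y. (real n + 1) ^ 3 - y) has_real_derivative - 1) (at 0)"
    by (auto intro!: derivative_eq_intros)
  from DERIV_mult[OF Suc this]
  have d: "((\<lambda>y. cubic_den y (Suc n)) has_real_derivative
      - (cubic_den 0 n * gen_harm 3 n) * ((real n + 1) ^ 3 - 0) + - 1 * cubic_den 0 n) (at 0)"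
    by (simp add: cubic_den_def)
  define a where "a = (real n + 1) ^ 3"
  have "a > 0" by (simp add: a_def)
  then have "- (cubic_den 0 n * s) * (a - 0) + - 1 * cubic_den 0 n = - (cubic_den 0 n * (a - 0) * (s + 1 / a))" for s
    by (simp add: field_simps)
  from d[folded a_def, unfolded this] show ?case
    unfolding gen_harm_Suc by (simp add: cubic_den_def a_def)
qed (simp add: cubic_den_def)

definition ramanujan_coeff :: "nat \<Rightarrow> real" where
  "ramanujan_coeff n = (1 / 64) ^ n * (pochhammer (1 / 2) n ^ 3 / pochhammer 1 n ^ 3)"

lemma cubic_quotient_0: "(cubic_num 0 n)\<^sup>2 / cubic_den 0 (2 * n) = ramanujan_coeff n"
proof -
  have num: "cubic_num 0 n = pochhammer (1 / 2) n ^ 3"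
    by (simp add: cubic_num_def pochhammer_prod lessThan_atLeast0 prod_power_distrib add_ac)
  have "cubic_den 0 (2 * n) = fact (2 * n) ^ 3"
    unfolding cubic_den_def fact_prod_Suc by (simp add: lessThan_atLeast0 prod_power_distrib add_ac)
  also have "\<dots> = 64 ^ n * pochhammer (1 / 2) n ^ 3 * fact n ^ 3"
  proof -
    have "((2::real) ^ (2 * n)) ^ 3 = (2 ^ 6) ^ n"
      by (simp only: power_mult [symmetric] mult_ac) simp
    then show ?thesis unfolding fact_double power_mult_distrib by simp
  qed
  finally have den: "cubic_den 0 (2 * n) = 64 ^ n * pochhammer (1 / 2) n ^ 3 * fact n ^ 3" .
  define p where "p = (pochhammer (1 / 2) n :: real) ^ 3"
  have "pochhammer (1 / 2) n > (0::real)" by (intro pochhammer_pos) auto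
  then have "p > 0" by (simp add: p_def)
  then show ?thesis unfolding num den ramanujan_coeff_def p_def [symmetric]
    by (simp add: pochhammer_fact [symmetric] power2_eq_square power_divide)
qed

definition fast_deriv :: "nat \<Rightarrow> real" where
  "fast_deriv n = ramanujan_coeff n *
     ((42 * real n + 5) * (17 * gen_harm 3 (2 * n) - 2 * gen_harm 3 n) - 27 / (2 * real n + 1)\<^sup>2)"

text \<open>Logarithmic differentiation: the squared numerator contributes \<open>2 (8 H_2n - H_n)\<close>, the
  denominator \<open>H_2n\<close>.\<close>

lemma fast_term_deriv: "((\<lambda>y. fast_term y n) has_real_derivative fast_deriv n) (at 0)"
proof -
  define P Q where "P = cubic_num 0 n" and "Q = cubic_den 0 (2 * n)"
  define S H where "S = 8 * gen_harm 3 (2 * n) - gen_harm 3 n" and "H = gen_harm 3 (2 * n)"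
  define b where "b = 2 * real n + 1"
  have pos: "P > 0" "Q > 0" "b > 0"
    using cubic_num_0_pos cubic_den_0_pos by (auto simp: P_def Q_def b_def)
  have dP: "((\<lambda>y. cubic_num y n) has_real_derivative P * S) (at 0)"
    using cubic_num_deriv[of n] unfolding sum_half_odd_cubes P_def S_def .
  have dQ: "((\<lambda>y. cubic_den y (2 * n)) has_real_derivative - (Q * H)) (at 0)"
    using cubic_den_deriv[of "2 * n"] unfolding Q_def H_def .
  have dR: "((\<lambda>y. 42 * real n + 5 - 27 * y * b / (b ^ 3 - y)) has_real_derivative - (27 / b\<^sup>2)) (at 0)"
    using pos by (auto intro!: derivative_eq_intros simp: power2_eq_square power3_eq_cube)
  have dPQ: "((\<lambda>y. (cubic_num y n)\<^sup>2 / cubic_den y (2 * n)) has_real_derivative P\<^sup>2 / Q * (2 * S + H)) (at 0)"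
    by (rule derivative_eq_intros dP dQ refl)+
       (use pos in \<open>simp_all add: P_def [symmetric] Q_def [symmetric] power2_eq_square divide_simps\<close>, simp_all add: algebra_simps)
  have "P\<^sup>2 / Q = ramanujan_coeff n" unfolding P_def Q_def by (rule cubic_quotient_0)
  moreover have "((\<lambda>y. fast_term y n) has_real_derivative
      P\<^sup>2 / Q * (2 * S + H) * (42 * real n + 5) + - (27 / b\<^sup>2) * (P\<^sup>2 / Q)) (at 0)"
    using DERIV_mult[OF dPQ dR] unfolding fast_term_def b_def [symmetric] by (simp add: P_def Q_def)
  moreover have "r * (2 * S + H) * (42 * real n + 5) + - (27 / b\<^sup>2) * r
      = r * ((42 * real n + 5) * (17 * gen_harm 3 (2 * n) - 2 * gen_harm 3 n) - 27 / (2 * real n + 1)\<^sup>2)" for r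
    by (simp add: S_def H_def b_def algebra_simps)
  ultimately show ?thesis unfolding fast_deriv_def by simp
qed

lemma ramanujan_coeff_bounds: "0 < ramanujan_coeff n" "ramanujan_coeff n \<le> (1 / 64) ^ n"
proof -
  have p: "pochhammer (1 / 2) n > (0::real)" "pochhammer 1 n > (0::real)" by (auto intro!: pochhammer_pos)
  then show "0 < ramanujan_coeff n" by (simp add: ramanujan_coeff_def)
  have "pochhammer (1 / 2) n \<le> (pochhammer 1 n :: real)"
    unfolding pochhammer_prod by (intro prod_mono) auto
  then have "pochhammer (1 / 2) n ^ 3 \<le> (pochhammer 1 n :: real) ^ 3" using p by (intro power_mono) auto
  then have "pochhammer (1 / 2) n ^ 3 / (pochhammer 1 n :: real) ^ 3 \<le> 1" using p by simp
  from mult_left_mono[OF this, of "(1 / 64) ^ n"] show "ramanujan_coeff n \<le> (1 / 64) ^ n"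
    by (simp add: ramanujan_coeff_def)
qed

lemma fast_term_0: "fast_term 0 n = ramanujan_coeff n * (42 * real n + 5)"
  by (simp add: fast_term_def cubic_quotient_0)

text \<open>The factors \<open>1 + y / (i + 1/2)^3\<close> lie in \<open>[0, 1]\<close>, and Weierstrass' product inequality
  bounds their product from below.\<close>

lemma cubic_num_ratio_bounds:
  assumes y: "- 1 / 64 \<le> y" "y < 0"
  shows "0 \<le> cubic_num y n / cubic_num 0 n" "cubic_num y n / cubic_num 0 n \<le> 1"
    "1 + 8 * real n * y \<le> cubic_num y n / cubic_num 0 n"
proof -
  define f where "f i = - y / (real i + 1 / 2) ^ 3" for i
  have "(real i + 1 / 2) ^ 3 \<ge> (1 / 2) ^ 3" for i by (intro power_mono) auto
  then have cube: "(real i + 1 / 2) ^ 3 \<ge> 1 / 8" for i by (simp add: power3_eq_cube)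
  have f8: "f i \<le> 8 * (- y)" for i
  proof -
    have "- y / (real i + 1 / 2) ^ 3 \<le> - y / (1 / 8)"
      using cube[of i] y by (intro divide_left_mono mult_pos_pos) auto
    then show ?thesis by (simp add: f_def)
  qed
  have f: "f i \<in> {0..1}" for i
  proof -
    have "(real i + 1 / 2) ^ 3 > 0" using cube[of i] by linarith
    then have "0 \<le> f i" unfolding f_def using y by (intro divide_nonneg_pos) auto
    then show ?thesis using f8[of i] y by simp
  qed
  have "cubic_num y n / cubic_num 0 n = (\<Prod>i<n. ((real i + 1 / 2) ^ 3 + y) / ((real i + 1 / 2) ^ 3 + 0))"
    by (simp only: cubic_num_def prod_dividef)
  also have "\<dots> = (\<Prod>i<n. 1 - f i)"
  proof (rule prod.cong)
    fix i
    have "(real i + 1 / 2) ^ 3 \<noteq> 0" using cube[of i] by linarith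
    then show "((real i + 1 / 2) ^ 3 + y) / ((real i + 1 / 2) ^ 3 + 0) = 1 - f i"
      unfolding f_def by (simp add: add_divide_distrib)
  qed simp
  finally have eq: "cubic_num y n / cubic_num 0 n = (\<Prod>i<n. 1 - f i)" .
  show "0 \<le> cubic_num y n / cubic_num 0 n" unfolding eq using f by (intro prod_nonneg) auto
  show "cubic_num y n / cubic_num 0 n \<le> 1" unfolding eq using f by (intro prod_le_1) auto
  have "1 + 8 * real n * y \<le> 1 - (\<Sum>i<n. f i)"
    using sum_bounded_above[of "{..<n}" f "8 * (- y)"] f8 by simp
  also have "\<dots> \<le> (\<Prod>i<n. 1 - f i)" by (intro Weierstrass_prod_ineq f)
  finally show "1 + 8 * real n * y \<le> cubic_num y n / cubic_num 0 n" unfolding eq .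
qed

lemma cubic_den_ratio_inverse_bounds:
  assumes y: "- 1 / 64 \<le> y" "y < 0"
  shows "0 \<le> cubic_den 0 n / cubic_den y n" "cubic_den 0 n / cubic_den y n \<le> 1"
    "1 + real n * y \<le> cubic_den 0 n / cubic_den y n"
proof -
  define f where "f i = - y / ((real i + 1) ^ 3 - y)" for i
  have cube: "(real i + 1) ^ 3 \<ge> 1" for i by (intro one_le_power) auto
  have f1: "f i \<le> - y" for i
  proof -
    have "(real i + 1) ^ 3 - y \<ge> 1" using cube[of i] y by linarith
    then have "- y / ((real i + 1) ^ 3 - y) \<le> - y / 1"
      using y by (intro divide_left_mono mult_pos_pos) linarith+
    then show ?thesis by (simp add: f_def)
  qed
  have f: "f i \<in> {0..1}" for i
  proof -
    have "(real i + 1) ^ 3 - y > 0" using cube[of i] y by linarith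
    then have "0 \<le> f i" unfolding f_def using y by (intro divide_nonneg_pos) auto
    then show ?thesis using f1[of i] y by simp
  qed
  have "cubic_den 0 n / cubic_den y n = (\<Prod>i<n. ((real i + 1) ^ 3 - 0) / ((real i + 1) ^ 3 - y))"
    by (simp only: cubic_den_def prod_dividef)
  also have "\<dots> = (\<Prod>i<n. 1 - f i)"
  proof (rule prod.cong)
    fix i
    have "(real i + 1) ^ 3 - y \<noteq> 0" using cube[of i] y by linarith
    then show "((real i + 1) ^ 3 - 0) / ((real i + 1) ^ 3 - y) = 1 - f i"
      unfolding f_def by (simp add: divide_simps)
  qed simp
  finally have eq: "cubic_den 0 n / cubic_den y n = (\<Prod>i<n. 1 - f i)" .
  show "0 \<le> cubic_den 0 n / cubic_den y n" unfolding eq using f by (intro prod_nonneg) auto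
  show "cubic_den 0 n / cubic_den y n \<le> 1" unfolding eq using f by (intro prod_le_1) auto
  have "1 + real n * y \<le> 1 - (\<Sum>i<n. f i)"
    using sum_bounded_above[of "{..<n}" f "- y"] f1 by simp
  also have "\<dots> \<le> (\<Prod>i<n. 1 - f i)" by (intro Weierstrass_prod_ineq f)
  finally show "1 + real n * y \<le> cubic_den 0 n / cubic_den y n" unfolding eq .
qed

text \<open>A majorant for Tannery's theorem. Since the terms decay like \<open>64^(-n)\<close>, crude bounds suffice: the
  deformed product differs from its value at 0 by at most \<open>18 n \<bar>y\<bar>\<close> relatively, and the polynomial
  factor is absorbed into \<open>4^n\<close>.\<close>

lemma fast_term_quotient_bound:
  assumes y: "- 1 / 64 \<le> y" "y < 0"
  shows "\<bar>(fast_term y n - fast_term 0 n) / y\<bar> \<le> 873 * (1 / 16) ^ n"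
proof -
  define a where "a = cubic_num y n / cubic_num 0 n"
  define d where "d = cubic_den 0 (2 * n) / cubic_den y (2 * n)"
  define B where "B = a * a * d"
  define x where "x = real n"
  have a: "0 \<le> a" "a \<le> 1" "1 - a \<le> 8 * x * (- y)"
    using cubic_num_ratio_bounds[OF y, of n] by (auto simp: a_def x_def)
  have d: "0 \<le> d" "d \<le> 1" "1 - d \<le> 2 * x * (- y)"
    using cubic_den_ratio_inverse_bounds[OF y, of "2 * n"] by (auto simp: d_def x_def)
  have B: "0 \<le> B" "B \<le> 1" "1 - B \<le> 18 * x * (- y)"
  proof -
    have aa: "a * a \<le> 1" "0 \<le> a * a" using a by (auto intro: mult_le_one)
    then show "0 \<le> B" "B \<le> 1" using d by (auto simp: B_def intro: mult_le_one)
    have "1 - B = (1 - a) + a * (1 - a) + a * a * (1 - d)" by (simp add: B_def algebra_simps)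
    also have "\<dots> \<le> (1 - a) + 1 * (1 - a) + 1 * (1 - d)"
      using a d aa by (intro add_mono mult_right_mono) auto
    also have "\<dots> \<le> 18 * x * (- y)" using a(3) d(3) by (simp add: algebra_simps)
    finally show "1 - B \<le> 18 * x * (- y)" .
  qed
  let ?C = "ramanujan_coeff n"
  let ?b = "2 * x + 1"
  have x: "x \<ge> 0" by (simp add: x_def)
  have quot: "(cubic_num y n)\<^sup>2 / cubic_den y (2 * n) = ?C * B"
    unfolding cubic_quotient_0 [symmetric] B_def a_def d_def power2_eq_square
    using cubic_num_0_pos[of n] cubic_den_0_pos[of "2 * n"] by simp
  have "fast_term y n - fast_term 0 n = ?C * ((42 * x + 5) * (B - 1) - B * (27 * y * ?b / (?b ^ 3 - y)))"
    unfolding fast_term_0 unfolding fast_term_def quot x_def [symmetric] by (simp add: algebra_simps)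
  then have eq: "(fast_term y n - fast_term 0 n) / y
      = ?C * (((42 * x + 5) * ((1 - B) / (- y))) + - (27 * B * (?b / (?b ^ 3 - y))))"
    using y by (simp add: field_simps)
  have t1: "\<bar>(42 * x + 5) * ((1 - B) / (- y))\<bar> \<le> (42 * x + 5) * (18 * x)"
  proof -
    have "0 \<le> (1 - B) / (- y)" using B y by (intro divide_nonneg_pos) auto
    moreover have "(1 - B) / (- y) \<le> 18 * x" using B y by (subst pos_divide_le_eq) auto
    ultimately have "0 \<le> (42 * x + 5) * ((1 - B) / (- y))" "(42 * x + 5) * ((1 - B) / (- y)) \<le> (42 * x + 5) * (18 * x)"
      using x by (intro mult_nonneg_nonneg mult_left_mono; simp)+
    then show ?thesis by (simp only: abs_of_nonneg)
  qed
  have t2: "\<bar>- (27 * B * (?b / (?b ^ 3 - y)))\<bar> \<le> 27"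
  proof -
    have "?b * 1 \<le> ?b * ?b\<^sup>2" using x by (intro mult_left_mono one_le_power) auto
    then have "?b \<le> ?b ^ 3" by (simp add: power2_eq_square power3_eq_cube)
    then have "?b / (?b ^ 3 - y) \<le> 1" "?b / (?b ^ 3 - y) \<ge> 0" using x y by simp_all
    then have "B * (?b / (?b ^ 3 - y)) \<le> 1" "0 \<le> B * (?b / (?b ^ 3 - y))"
      using B(1,2) by (blast intro: mult_le_one mult_nonneg_nonneg)+
    moreover have "\<bar>- (27 * u * v)\<bar> \<le> 27" if "u * v \<le> 1" "0 \<le> u * v" for u v :: real
      using that by (simp add: mult.assoc abs_of_nonneg)
    ultimately show ?thesis by blast
  qed
  have four: "(42 * x + 5) * (18 * x) + 27 \<le> 873 * 4 ^ n"
  proof -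
    have "real n \<le> 2 ^ n" "(1::real) \<le> 2 ^ n" using of_nat_less_two_power[of n] by (auto intro: less_imp_le)
    then have "42 * x + 5 \<le> 47 * 2 ^ n" "18 * x \<le> 18 * 2 ^ n" "(1::real) * 1 \<le> 2 ^ n * 2 ^ n"
      unfolding x_def by (linarith, linarith, intro mult_mono) auto
    then have "(42 * x + 5) * (18 * x) + 27 \<le> (47 * 2 ^ n) * (18 * 2 ^ n) + 27 * (2 ^ n * 2 ^ n)"
      using x by (intro add_mono mult_mono) auto
    also have "\<dots> = 873 * 4 ^ n" by (simp add: power_mult_distrib [symmetric])
    finally show ?thesis .
  qed
  have "\<bar>(fast_term y n - fast_term 0 n) / y\<bar> \<le> ?C * ((42 * x + 5) * (18 * x) + 27)"
    unfolding eq abs_mult using ramanujan_coeff_bounds(1)[of n] t1 t2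
    by (simp only: abs_of_pos) (intro mult_left_mono order_trans[OF abs_triangle_ineq] add_mono; simp)
  also have "\<dots> \<le> (1 / 64) ^ n * (873 * 4 ^ n)"
    using ramanujan_coeff_bounds[of n] four x by (intro mult_mono) auto
  also have "\<dots> = 873 * (1 / 16) ^ n" by (simp add: power_mult_distrib [symmetric])
  finally show ?thesis .
qed

lemma summable_fast_term_0: "summable (fast_term 0)"
proof (rule summable_comparison_test')
  show "summable (\<lambda>n. 47 * (1 / 32 :: real) ^ n)" by (intro summable_mult summable_geometric) auto
  fix n :: nat
  have "real n \<le> 2 ^ n" "(1::real) \<le> 2 ^ n" using of_nat_less_two_power[of n] by (auto intro: less_imp_le)
  then have "42 * real n + 5 \<le> 47 * 2 ^ n" by linarith
  then have "ramanujan_coeff n * (42 * real n + 5) \<le> (1 / 64) ^ n * (47 * 2 ^ n)"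
    using ramanujan_coeff_bounds[of n] by (intro mult_mono) auto
  also have "\<dots> = 47 * (1 / 32) ^ n" by (simp add: power_mult_distrib [symmetric])
  finally show "norm (fast_term 0 n) \<le> 47 * (1 / 32) ^ n"
    using ramanujan_coeff_bounds(1)[of n] by (simp add: fast_term_0)
qed

lemma cube_filterlim: "filterlim (\<lambda>w::real. w ^ 3) (at 0) (at_left 0)"
proof (rule filterlim_atI)
  have "((\<lambda>w::real. w ^ 3) \<longlongrightarrow> 0 ^ 3) (at_left 0)" by (intro tendsto_intros)
  then show "((\<lambda>w::real. w ^ 3) \<longlongrightarrow> 0) (at_left 0)" by simp
  show "\<forall>\<^sub>F w in at_left 0. w ^ 3 \<noteq> (0::real)"
    by (auto simp: eventually_at_left_field intro!: exI[of _ "- 1"])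
qed

lemma cube_bounds: "- 1 / 4 \<le> w \<Longrightarrow> w < 0 \<Longrightarrow> - 1 / 64 \<le> w ^ 3 \<and> w ^ 3 < (0::real)"
proof -
  assume w: "- 1 / 4 \<le> w" "w < 0"
  have "(- w) ^ 3 \<le> (1 / 4) ^ 3" using w by (intro power_mono) auto
  then show ?thesis using w by (simp add: power3_eq_cube mult_less_0_iff zero_less_mult_iff)
qed

lemma fast_quotient_tendsto:
  "summable fast_deriv"
  "((\<lambda>w. (suminf (fast_term (w ^ 3)) - suminf (fast_term 0)) / w ^ 3) \<longlongrightarrow> suminf fast_deriv) (at_left 0)"
proof -
  let ?q = "\<lambda>n w. (fast_term (w ^ 3) n - fast_term 0 n) / w ^ 3"
  have "((\<lambda>w. ?q n w) \<longlongrightarrow> fast_deriv n) (at_left 0)" for n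
  proof -
    have "((\<lambda>y. (fast_term y n - fast_term 0 n) / (y - 0)) \<longlongrightarrow> fast_deriv n) (at 0)"
      using fast_term_deriv[of n] unfolding has_field_derivative_iff .
    from filterlim_compose[OF this cube_filterlim] show ?thesis by simp
  qed
  moreover have "\<forall>\<^sub>F (n, w) in at_top \<times>\<^sub>F at_left 0. norm (?q n w) \<le> 873 * (1 / 16) ^ n"
    unfolding eventually_prod_filter
    by (rule exI[of _ "\<lambda>_. True"], rule exI[of _ "\<lambda>w. - 1 / 4 \<le> w \<and> w < 0"])
       (use eventually_small_negative fast_term_quotient_bound cube_bounds in auto)
  moreover have "summable (\<lambda>n. 873 * (1 / 16 :: real) ^ n)"
    by (intro summable_mult summable_geometric) auto
  ultimately have T: "(\<forall>\<^sub>F w in at_left 0. summable (\<lambda>n. norm (?q n w))) \<and> summable (\<lambda>n. norm (fast_deriv n)) \<and>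
      ((\<lambda>w. \<Sum>n. ?q n w) \<longlongrightarrow> suminf fast_deriv) (at_left 0)"
    by (intro tannerys_theorem) auto
  then show "summable fast_deriv" by (blast intro: summable_norm_cancel)
  have "\<forall>\<^sub>F w in at_left 0. (\<Sum>n. ?q n w) = (suminf (fast_term (w ^ 3)) - suminf (fast_term 0)) / w ^ 3"
    using eventually_small_negative
  proof eventually_elim
    case (elim w)
    then have "summable (fast_term (w ^ 3))"
      using fast_sums_damped[of w] by (auto simp: sums_iff)
    then show ?case
      by (simp add: suminf_divide suminf_diff summable_diff summable_fast_term_0)
  qed
  with T show "((\<lambda>w. (suminf (fast_term (w ^ 3)) - suminf (fast_term 0)) / w ^ 3) \<longlongrightarrow> suminf fast_deriv) (at_left 0)"
    using tendsto_cong by fast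
qed

text \<open>Subtracting the correction term isolates the product \<open>A\<close>, whose difference quotient is
  squeezed between those of \<open>1 / (1 - y zeta 3)\<close> and \<open>exp (y zeta 3)\<close>. Dividing by the
  negative \<open>w^3\<close> reverses the inequalities.\<close>

lemma damped_quotient_tendsto:
  "((\<lambda>w. (suminf (fast_term (w ^ 3)) - 16 / pi) / w ^ 3) \<longlongrightarrow> 240 * zeta 3 / pi - 128 * catalan_const) (at_left 0)"
proof -
  let ?z = "zeta 3 :: real"
  let ?D = "\<lambda>w. \<Sum>k. corr_term w k"
  define A where "A w = pi * (suminf (fast_term (w ^ 3)) / 16 + w ^ 3 * ?D w)" for w
  have A: "exp (w ^ 3 * ?z) \<le> A w \<and> A w \<le> 1 / (1 - w ^ 3 * ?z)" if w: "- 1 / 4 \<le> w" "w < 0" for w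
  proof -
    obtain A' where A': "fast_term (w ^ 3) sums (16 * (A' / pi - w ^ 3 * ?D w))"
      "exp (w ^ 3 * ?z) \<le> A'" "A' \<le> 1 / (1 - w ^ 3 * ?z)"
      using fast_sums_corrected[OF w] by metis
    have "A w = A'" unfolding A_def using A'(1) by (simp add: sums_iff field_simps)
    then show ?thesis using A' by simp
  qed
  have "((\<lambda>w. (A w - 1) / w ^ 3) \<longlongrightarrow> ?z) (at_left 0)"
  proof (rule real_tendsto_sandwich)
    have "((\<lambda>w. ?z / (1 - w ^ 3 * ?z)) \<longlongrightarrow> ?z / (1 - 0 ^ 3 * ?z)) (at_left 0)"
      by (intro tendsto_intros) auto
    then show "((\<lambda>w. ?z / (1 - w ^ 3 * ?z)) \<longlongrightarrow> ?z) (at_left 0)" by simp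
    have "((\<lambda>y. exp (y * ?z)) has_real_derivative ?z) (at 0)"
      by (auto intro!: derivative_eq_intros)
    then have "((\<lambda>y. (exp (y * ?z) - exp (0 * ?z)) / (y - 0)) \<longlongrightarrow> ?z) (at 0)"
      unfolding has_field_derivative_iff .
    from filterlim_compose[OF this cube_filterlim]
    show "((\<lambda>w. (exp (w ^ 3 * ?z) - 1) / w ^ 3) \<longlongrightarrow> ?z) (at_left 0)" by simp
    show "\<forall>\<^sub>F w in at_left 0. (A w - 1) / w ^ 3 \<le> (exp (w ^ 3 * ?z) - 1) / w ^ 3"
      using eventually_small_negative
    proof eventually_elim
      case (elim w)
      then show ?case using A[of w] cube_bounds[of w] by (intro divide_right_mono_neg) auto
    qed
    show "\<forall>\<^sub>F w in at_left 0. ?z / (1 - w ^ 3 * ?z) \<le> (A w - 1) / w ^ 3"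
      using eventually_small_negative
    proof eventually_elim
      case (elim w)
      then have y: "w ^ 3 < 0" and up: "A w \<le> 1 / (1 - w ^ 3 * ?z)"
        using A[of w] cube_bounds[of w] by auto
      have "?z \<ge> 0" using sums_le[OF _ sums_zero zeta_3_sums] by simp
      then have "1 - w ^ 3 * ?z > 0" using y mult_nonpos_nonneg[of "w ^ 3" ?z] by linarith
      moreover have "c / (1 - y * c) = (1 / (1 - y * c) - 1) / y" if "1 - y * c > 0" "y < 0" for y c :: real
        using that by (simp add: divide_simps)
      ultimately have "?z / (1 - w ^ 3 * ?z) = (1 / (1 - w ^ 3 * ?z) - 1) / w ^ 3"
        using y by blast
      also have "\<dots> \<le> (A w - 1) / w ^ 3" using up y by (intro divide_right_mono_neg) auto
      finally show ?case .
    qed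
  qed
  then have "((\<lambda>w. 16 / pi * ((A w - 1) / w ^ 3) - 16 * ?D w) \<longlongrightarrow>
      16 / pi * ?z - 16 * (8 * catalan_const - 14 * ?z / pi)) (at_left 0)"
    by (intro tendsto_intros corr_suminf_tendsto)
  moreover have "\<forall>\<^sub>F w in at_left 0. 16 / pi * ((A w - 1) / w ^ 3) - 16 * ?D w
      = (suminf (fast_term (w ^ 3)) - 16 / pi) / w ^ 3"
    using eventually_small_negative
  proof eventually_elim
    case (elim w)
    then show ?case by (simp add: A_def field_simps)
  qed
  ultimately have "((\<lambda>w. (suminf (fast_term (w ^ 3)) - 16 / pi) / w ^ 3) \<longlongrightarrow>
      16 / pi * ?z - 16 * (8 * catalan_const - 14 * ?z / pi)) (at_left 0)"
    by (simp add: tendsto_cong)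
  then show ?thesis by (simp add: algebra_simps)
qed

theorem theorem1p4:
  shows "(\<lambda>k. (1 / 64 :: real) ^ k * (pochhammer (1 / 2) k ^ 3 / pochhammer 1 k ^ 3) *
           ((42 * real k + 5) * (17 * gen_harm 3 (2 * k) - 2 * gen_harm 3 k)
              - 27 / (2 * real k + 1)\<^sup>2))
         sums (240 * zeta 3 / pi - 128 * catalan_const)"
proof -
  let ?L = "240 * zeta 3 / pi - 128 * catalan_const"
  let ?f = "\<lambda>w. suminf (fast_term (w ^ 3))"
  have cube0: "((\<lambda>w::real. w ^ 3) \<longlongrightarrow> 0) (at_left 0)"
    using cube_filterlim by (simp add: filterlim_at)
  have "((\<lambda>w. (?f w - suminf (fast_term 0)) / w ^ 3 - (?f w - 16 / pi) / w ^ 3) \<longlongrightarrow> suminf fast_deriv - ?L) (at_left 0)"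
    by (intro tendsto_diff fast_quotient_tendsto damped_quotient_tendsto)
  moreover have "(?f w - suminf (fast_term 0)) / w ^ 3 - (?f w - 16 / pi) / w ^ 3 = (16 / pi - suminf (fast_term 0)) / w ^ 3" for w
    by (simp add: diff_divide_distrib)
  ultimately have q: "((\<lambda>w. (16 / pi - suminf (fast_term 0)) / w ^ 3) \<longlongrightarrow> suminf fast_deriv - ?L) (at_left 0)"
    by simp
  have "((\<lambda>w. (16 / pi - suminf (fast_term 0)) / w ^ 3 * w ^ 3) \<longlongrightarrow> (suminf fast_deriv - ?L) * 0) (at_left 0)"
    by (intro tendsto_mult q cube0)
  moreover have "\<forall>\<^sub>F w in at_left 0. (16 / pi - suminf (fast_term 0)) / w ^ 3 * w ^ 3 = 16 / pi - suminf (fast_term 0)"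
    using eventually_small_negative by eventually_elim auto
  ultimately have "((\<lambda>w::real. 16 / pi - suminf (fast_term 0)) \<longlongrightarrow> 0) (at_left 0)"
    by (simp add: tendsto_cong)
  \<comment> \<open>The difference quotients converge with either subtrahend, so the subtrahends agree. This recovers Ramanujan's series.\<close>
  then have "16 / pi - suminf (fast_term 0) = 0"
    by (simp add: tendsto_const_iff)
  with q have "((\<lambda>w::real. 0) \<longlongrightarrow> suminf fast_deriv - ?L) (at_left 0)" by simp
  then have "suminf fast_deriv - ?L = 0"
    by (simp add: tendsto_const_iff)
  then have "fast_deriv sums ?L"
    using summable_sums[OF fast_quotient_tendsto(1)] by simp
  then show ?thesis unfolding fast_deriv_def ramanujan_coeff_def .
qed

end
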